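(* Let $d\in\mathbb{N}$ and $p\in(1,2)$, and let $p'$ be given by $\frac1p+\frac1{p'}=1$. The discrete Fourier transform $\mathscr{F}$, $\boldsymbol\xi\mapsto\{(\mathscr{F}\boldsymbol\xi)(m)\}_{m\in\mathbb{Z}^d}$, is a bounded linear operator from the space $L^p(\mathbb{T}^d)$ into the sequence space $l^{p',p}(\mathbb{Z}^d)$; however, it is not strictly singular.
   Context: $\mathbb{T}^d=[-\pi,\pi]^d$ is the $d$-dimensional torus with Lebesgue measure, and $L^p(\mathbb{T}^d)$ is the usual Lebesgue space on it. Functions and sequences are complex-valued. The discrete Fourier transform of an integrable function $\boldsymbol\xi$ on $\mathbb{T}^d$ is $$(\mathscr{F}\boldsymbol\xi)(m)=\int_{\mathbb{T}^d}\boldsymbol\xi(t)e^{-i\langle t,m\rangle}\,dt,\qquad m\in\mathbb{Z}^d,$$ where $\langle t,m\rangle=\sum_{k=1}^d t_km_k$. The Lorentz sequence space $l^{p',p}(\mathbb{Z}^d)$ is the space of all sequences $\mathbf{c}=\{c_m\}_{m\in\mathbb{Z}^d}$ such that $$\|\mathbf{c}\|_{p',p}=\Big(\sum_{k=1}^\infty\big(k^{1/p'-1/p}c_k^*\big)^p\Big)^{1/p}<\infty,$$ where $\{c_k^*\}_{k=1}^\infty$ denotes the non-increasing rearrangement of the sequence $\{|c_m|\}_{m\in\mathbb{Z}^d}$. A bounded linear operator $T:X\to Y$ between Banach spaces is strictly singular if it does not induce an isomorphism on any infinite-dimensional closed subspace of $X$; specifically, if for every infinite-dimensional closed subspace $E\subset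 X$ and every $\varepsilon>0$ there exists $x$ in the unit sphere of $E$ such that $\|T(x)\|_Y\le\varepsilon$. *)

theory Defs
  imports "HOL-Analysis.Analysis" "HOL-Library.Function_Algebras"
begin

text \<open>
  The spaces below depend on a real exponent, so they are not types. They are linear
  subspaces \<open>vcarrier\<close> of an ambient complex vector space; \<open>vnorm\<close> is only meaningful on
  \<open>vcarrier\<close>.
\<close>

record 'a normed_sp =
  vscale :: "complex \<Rightarrow> 'a \<Rightarrow> 'a"
  vcarrier :: "'a set"
  vnorm :: "'a \<Rightarrow> real"

definition bounded_linear_operator ::
    "('a::ab_group_add) normed_sp \<Rightarrow> ('b::ab_group_add) normed_sp \<Rightarrow> ('a \<Rightarrow> 'b) \<Rightarrow> bool" where
  "bounded_linear_operator X Y T \<longleftrightarrow>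
     (\<forall>x\<in>vcarrier X. T x \<in> vcarrier Y) \<and>
     (\<forall>x\<in>vcarrier X. \<forall>y\<in>vcarrier X. T (x + y) = T x + T y) \<and>
     (\<forall>a. \<forall>x\<in>vcarrier X. T (vscale X a x) = vscale Y a (T x)) \<and>
     (\<exists>C. \<forall>x\<in>vcarrier X. vnorm Y (T x) \<le> C * vnorm X x)"

definition closed_subspace :: "('a::ab_group_add) normed_sp \<Rightarrow> 'a set \<Rightarrow> bool" where
  "closed_subspace X E \<longleftrightarrow>
     E \<subseteq> vcarrier X \<and> module.subspace (vscale X) E \<and>
     (\<forall>s x. (\<forall>n::nat. s n \<in> E) \<and> x \<in> vcarrier X \<and> (\<lambda>n. vnorm X (s n - x)) \<longlonglongrightarrow> 0 \<longrightarrow> x \<in> E)"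

definition infinite_dimensional :: "('a::ab_group_add) normed_sp \<Rightarrow> 'a set \<Rightarrow> bool" where
  "infinite_dimensional X E \<longleftrightarrow> (\<nexists>B. finite B \<and> B \<subseteq> E \<and> module.span (vscale X) B = E)"

definition strictly_singular ::
    "('a::ab_group_add) normed_sp \<Rightarrow> ('b::ab_group_add) normed_sp \<Rightarrow> ('a \<Rightarrow> 'b) \<Rightarrow> bool" where
  "strictly_singular X Y T \<longleftrightarrow>
     (\<forall>E. closed_subspace X E \<and> infinite_dimensional X E \<longrightarrow>
        (\<forall>\<epsilon>>0. \<exists>x\<in>E. vnorm X x = 1 \<and> vnorm Y (T x) \<le> \<epsilon>))"

abbreviation torus :: "(real ^ 'd::finite) measure" where
  "torus \<equiv> lebesgue_on (cbox (\<chi> i. - pi) (\<chi> i. pi))"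

definition torus_rel :: "(real ^ 'd::finite \<Rightarrow> complex) \<Rightarrow> (real ^ 'd \<Rightarrow> complex) \<Rightarrow> bool" where
  "torus_rel f g \<longleftrightarrow> f \<in> borel_measurable torus \<and> g \<in> borel_measurable torus \<and>
     (AE t in torus. f t = g t)"

lemma part_equivp_torus_rel: "part_equivp torus_rel"
proof (rule part_equivpI)
  show "\<exists>f::real ^ 'd \<Rightarrow> complex. torus_rel f f"
    by (rule exI[of _ "\<lambda>_. 0"]) (simp add: torus_rel_def)
  show "symp (torus_rel :: (real ^ 'd \<Rightarrow> complex) \<Rightarrow> _)"
    by (auto simp: symp_def torus_rel_def eq_commute)
  show "transp (torus_rel :: (real ^ 'd \<Rightarrow> complex) \<Rightarrow> _)"
    unfolding transp_def torus_rel_def by (auto elim: AE_mp)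
qed

text \<open>Measurable complex functions on the torus modulo equality almost everywhere.\<close>

quotient_type (overloaded) 'd torus_fun = "real ^ 'd::finite \<Rightarrow> complex" / partial: torus_rel
  by (rule part_equivp_torus_rel)

instantiation torus_fun :: (finite) ab_group_add
begin

lift_definition zero_torus_fun :: "'a torus_fun" is "\<lambda>_. 0"
  by (simp add: torus_rel_def)

lift_definition plus_torus_fun :: "'a torus_fun \<Rightarrow> 'a torus_fun \<Rightarrow> 'a torus_fun"
  is "\<lambda>f g t. f t + g t"
  unfolding torus_rel_def by auto

lift_definition minus_torus_fun :: "'a torus_fun \<Rightarrow> 'a torus_fun \<Rightarrow> 'a torus_fun"
  is "\<lambda>f g t. f t - g t"
  unfolding torus_rel_def by auto

lift_definition uminus_torus_fun :: "'a torus_fun \<Rightarrow> 'a torus_fun"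
  is "\<lambda>f t. - f t"
  unfolding torus_rel_def by auto

instance
  by standard (transfer; auto simp: torus_rel_def algebra_simps)+

end

lift_definition scale_torus_fun :: "complex \<Rightarrow> 'd::finite torus_fun \<Rightarrow> 'd torus_fun"
  is "\<lambda>a f t. a * f t"
  unfolding torus_rel_def by auto

lemma vector_space_torus_fun: "vector_space scale_torus_fun"
  by standard (transfer; auto simp: torus_rel_def algebra_simps)+

lift_definition Lp_integrable :: "real \<Rightarrow> 'd::finite torus_fun \<Rightarrow> bool"
  is "\<lambda>p f. integrable torus (\<lambda>t. cmod (f t) powr p)"
proof -
  fix p :: real and f g :: "real ^ 'd \<Rightarrow> complex"
  assume "torus_rel f g"
  then have [measurable]: "f \<in> borel_measurable torus" "g \<in> borel_measurable torus"
    and "AE t in torus. f t = g t" by (auto simp: torus_rel_def)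
  then show "integrable torus (\<lambda>t. cmod (f t) powr p) = integrable torus (\<lambda>t. cmod (g t) powr p)"
    by (intro integrable_cong_AE) auto
qed

lift_definition Lp_norm :: "real \<Rightarrow> 'd::finite torus_fun \<Rightarrow> real"
  is "\<lambda>p f. (integral\<^sup>L torus (\<lambda>t. cmod (f t) powr p)) powr (1 / p)"
proof -
  fix p :: real and f g :: "real ^ 'd \<Rightarrow> complex"
  assume "torus_rel f g"
  then have [measurable]: "f \<in> borel_measurable torus" "g \<in> borel_measurable torus"
    and "AE t in torus. f t = g t" by (auto simp: torus_rel_def)
  then have "integral\<^sup>L torus (\<lambda>t. cmod (f t) powr p) = integral\<^sup>L torus (\<lambda>t. cmod (g t) powr p)"
    by (intro integral_cong_AE) auto
  then show "(integral\<^sup>L torus (\<lambda>t. cmod (f t) powr p)) powr (1 / p) =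
    (integral\<^sup>L torus (\<lambda>t. cmod (g t) powr p)) powr (1 / p)" by simp
qed

definition Lp_space :: "real \<Rightarrow> ('d::finite torus_fun) normed_sp" where
  "Lp_space p =
     \<lparr>vscale = scale_torus_fun, vcarrier = {\<xi>. Lp_integrable p \<xi>}, vnorm = Lp_norm p\<rparr>"

text \<open>
  \<open>rearr c k\<close> is the \<open>k\<close>-th term, for \<open>k \<ge> 1\<close>, of the non-increasing rearrangement of
  \<open>|c|\<close>. It is meaningful for bounded \<open>c\<close>, when the set below is non-empty; for
  unbounded \<open>c\<close> the rearrangement is infinite, and so is the Lorentz norm.
\<close>

definition rearr :: "('i \<Rightarrow> complex) \<Rightarrow> nat \<Rightarrow> real" where
  "rearr c k = Inf {t. 0 \<le> t \<and> finite {m. t < cmod (c m)} \<and> card {m. t < cmod (c m)} < k}"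

text \<open>In the series, \<open>Suc k\<close> is the index counted from \<open>1\<close>.\<close>

definition lorentz_term :: "real \<Rightarrow> real \<Rightarrow> ('i \<Rightarrow> complex) \<Rightarrow> nat \<Rightarrow> real" where
  "lorentz_term q p c k = (real (Suc k) powr (1 / q - 1 / p) * rearr c (Suc k)) powr p"

definition lorentz_space :: "real \<Rightarrow> real \<Rightarrow> ('i \<Rightarrow> complex) normed_sp" where
  "lorentz_space q p =
     \<lparr>vscale = (\<lambda>a c m. a * c m),
      vcarrier = {c. bounded (range c) \<and> summable (lorentz_term q p c)},
      vnorm = (\<lambda>c. (\<Sum>k. lorentz_term q p c k) powr (1 / p))\<rparr>"

lemma vector_space_sequences: "vector_space (\<lambda>a (c::'i \<Rightarrow> complex) m. a * c m)"
  by standard (auto simp: fun_eq_iff algebra_simps)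

lift_definition fourier :: "'d::finite torus_fun \<Rightarrow> (int ^ 'd \<Rightarrow> complex)"
  is "\<lambda>f m. integral\<^sup>L torus
        (\<lambda>t. f t * exp (- \<i> * complex_of_real (\<Sum>k\<in>UNIV. t $ k * real_of_int (m $ k))))"
proof (rule ext)
  fix f g :: "real ^ 'd \<Rightarrow> complex" and m :: "int ^ 'd"
  let ?e = "\<lambda>t::real ^ 'd. exp (- \<i> * complex_of_real (\<Sum>k\<in>UNIV. t $ k * real_of_int (m $ k)))"
  assume "torus_rel f g"
  then have [measurable]: "f \<in> borel_measurable torus" "g \<in> borel_measurable torus"
    and ae: "AE t in torus. f t = g t" by (auto simp: torus_rel_def)
  have "continuous_on UNIV ?e" by (intro continuous_intros)
  then have e: "?e \<in> borel_measurable torus"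
    by (intro continuous_imp_measurable_on_sets_lebesgue) (auto intro: continuous_on_subset)
  show "(\<integral>t. f t * ?e t \<partial>torus) = (\<integral>t. g t * ?e t \<partial>torus)"
  proof (rule integral_cong_AE)
    show "(\<lambda>t. f t * ?e t) \<in> borel_measurable torus" "(\<lambda>t. g t * ?e t) \<in> borel_measurable torus"
      by (intro borel_measurable_times e; measurable)+
    show "AE t in torus. f t * ?e t = g t * ?e t"
      using ae by auto
  qed
qed

end

theory Submission
  imports Defs
begin

text \<open>
  Boundedness is Paley's inequality. For a fixed injective enumeration \<open>\<sigma>\<close> of frequencies, the
  linear map sending \<open>f\<close> to the sequence \<open>k c(\<sigma> k)\<close>, where \<open>c\<close> is the transform of \<open>f\<close>, is of weak
  type \<open>(1,1)\<close> and, by Bessel, of type \<open>(2,2)\<close> with respect to the weights \<open>1/k\<^sup>2\<close>. Marcinkiewicz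
  interpolation bounds \<open>\<Sum> k powr (p - 2) |c(\<sigma> k)|\<^sup>p\<close> uniformly in \<open>\<sigma>\<close>, and a suitable \<open>\<sigma>\<close> almost
  realises the rearrangement.

  For the failure of strict singularity, take the functions that on the slab
  \<open>\<delta>\<^sub>j < t\<^sub>i \<le> 2 \<delta>\<^sub>j\<close>, \<open>\<delta>\<^sub>j = 1 / 2 ^ (j + 2)\<close> (one fixed coordinate \<open>i\<close>) equal a constant \<open>\<alpha>\<^sub>j\<close> times
  \<open>exp (\<i> M\<^sub>j t\<^sub>i)\<close> for every \<open>j\<close>, with rapidly growing frequencies \<open>M\<^sub>j\<close>. Disjoint supports make
  this closed subspace of \<open>L\<^sup>p\<close> a copy of \<open>\<ell>\<^sup>p\<close>. The transform of the \<open>j\<close>-th piece has size about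
  \<open>|\<alpha>\<^sub>j| \<delta>\<^sub>j\<close> on about \<open>1 / \<delta>\<^sub>j\<close> frequencies next to \<open>M\<^sub>j\<close>, where the other pieces are negligible; the
  dyadic blocks of the Lorentz norm then recover \<open>\<Sum> |\<alpha>\<^sub>j|\<^sup>p \<delta>\<^sub>j\<close>.
\<close>

subsection \<open>Exponentials on the torus\<close>

text \<open>Lebesgue measure on \<open>real^'d\<close> is the image of the product measure over
  \<open>Basis\<close>, and \<open>axis i 1\<close> matches coordinates with basis vectors. Fubini
  for finite products then gives the claim.\<close>

lemma lborel_integral_prod:
  fixes g :: "'d::finite \<Rightarrow> real \<Rightarrow> complex"
  assumes g: "\<And>i. integrable lborel (g i)"
  shows "integrable lborel (\<lambda>x::real^'d. \<Prod>i\<in>UNIV. g i (x $ i))"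
    and "integral\<^sup>L lborel (\<lambda>x::real^'d. \<Prod>i\<in>UNIV. g i (x $ i)) = (\<Prod>i\<in>UNIV. \<integral>x. g i x \<partial>lborel)"
proof -
  let ?B = "Basis :: (real^'d) set"
  let ?h = "\<lambda>b::real^'d. g (axis_index b)"
  let ?T = "\<lambda>f::real^'d \<Rightarrow> real. \<Sum>b\<in>?B. f b *\<^sub>R b"
  interpret product_sigma_finite "\<lambda>b::real^'d. lborel :: real measure"
    by standard
  have m: "g i \<in> borel_measurable borel" for i
    using borel_measurable_integrable[OF g[of i]] by simp
  have m': "(\<lambda>x::real^'d. \<Prod>i\<in>UNIV. g i (x $ i)) \<in> borel_measurable borel"
  proof (rule borel_measurable_prod)
    fix i :: 'd
    have "(\<lambda>x::real^'d. x $ i) \<in> borel_measurable borel"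
      by (intro borel_measurable_continuous_onI continuous_intros)
    from measurable_compose[OF this m] show "(\<lambda>x::real^'d. g i (x $ i)) \<in> borel_measurable borel" .
  qed
  have T: "?T \<in> measurable (\<Pi>\<^sub>M b\<in>?B. lborel) borel"
    by measurable
  have B: "?B = (\<lambda>i. axis i 1) ` UNIV"
    by (auto simp: Basis_vec_def)
  have inj: "inj_on (\<lambda>i::'d. axis i (1::real)) UNIV"
    by (auto simp: inj_on_def axis_eq_axis)
  have comp: "?T f $ i = f (axis i 1)" for f i
  proof -
    have "?T f $ i = ?T f \<bullet> axis i 1"
      by (simp add: inner_axis)
    also have "\<dots> = f (axis i 1)"
      by (subst inner_sum_left_Basis) (auto simp: B)
    finally show ?thesis .
  qed
  have prodB: "(\<Prod>b\<in>?B. F b) = (\<Prod>i\<in>UNIV. F (axis i 1))" for F :: "real^'d \<Rightarrow> complex"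
    unfolding B by (subst prod.reindex[OF inj]) simp
  have eq: "(\<Prod>i\<in>UNIV. g i (?T f $ i)) = (\<Prod>b\<in>?B. ?h b (f b))" for f
    by (simp only: comp prodB axis_index_axis)
  have int: "integrable (\<Pi>\<^sub>M b\<in>?B. lborel) (\<lambda>f. \<Prod>b\<in>?B. ?h b (f b))"
    by (rule product_integrable_prod) (auto simp: g)
  show "integrable lborel (\<lambda>x::real^'d. \<Prod>i\<in>UNIV. g i (x $ i))"
    unfolding lborel_eq[where 'a="real^'d"] by (subst integrable_distr_eq[OF T m']) (simp only: eq int)
  have "integral\<^sup>L lborel (\<lambda>x::real^'d. \<Prod>i\<in>UNIV. g i (x $ i)) =
      (\<integral>f. (\<Prod>b\<in>?B. ?h b (f b)) \<partial>(\<Pi>\<^sub>M b\<in>?B. lborel))"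
    unfolding lborel_eq[where 'a="real^'d"] by (subst integral_distr[OF T m']) (simp only: eq)
  also have "\<dots> = (\<Prod>b\<in>?B. \<integral>x. ?h b x \<partial>lborel)"
    by (rule product_integral_prod) (auto simp: g)
  finally show "integral\<^sup>L lborel (\<lambda>x::real^'d. \<Prod>i\<in>UNIV. g i (x $ i)) = (\<Prod>i\<in>UNIV. \<integral>x. g i x \<partial>lborel)"
    by (simp only: prodB axis_index_axis)
qed

lemma mem_torus_iff: "(t::real^'d::finite) \<in> cbox (\<chi> i. - pi) (\<chi> i. pi) \<longleftrightarrow> (\<forall>i. t $ i \<in> {- pi..pi})"
  by (simp add: mem_box_cart)

text \<open>The indicator of the cube is the product of the interval indicators, so the integrand
  extended by zero is again a product. It is Borel, hence completing the measure does not change the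
  integral.\<close>

lemma torus_integral_prod:
  fixes g :: "'d::finite \<Rightarrow> real \<Rightarrow> complex"
  assumes g: "\<And>i. set_integrable lborel {-pi..pi} (g i)"
  shows "(\<integral>t. (\<Prod>i\<in>UNIV. g i (t $ i)) \<partial>(torus :: (real^'d) measure)) =
    (\<Prod>i\<in>UNIV. LINT x:{-pi..pi}|lborel. g i x)"
proof -
  let ?g = "\<lambda>i x. indicator {-pi..pi} x *\<^sub>R g i x"
  let ?C = "cbox (\<chi> i. - pi) (\<chi> i. pi) :: (real^'d) set"
  have i: "integrable lborel (?g i)" for i
    using g by (simp add: set_integrable_def)
  have e: "indicator ?C t *\<^sub>R (\<Prod>i\<in>UNIV. g i (t $ i)) = (\<Prod>i\<in>UNIV. ?g i (t $ i))" for t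
  proof (cases "t \<in> ?C")
    case True
    then show ?thesis using mem_torus_iff[of t] by simp
  next
    case False
    then obtain i where "t $ i \<notin> {-pi..pi}" using mem_torus_iff[of t] by blast
    then have "(\<Prod>i\<in>UNIV. ?g i (t $ i)) = 0"
      by (intro prod_zero) (auto intro!: exI[of _ i])
    with False show ?thesis by (simp only: indicator_simps) simp
  qed
  have "(\<integral>t. (\<Prod>i\<in>UNIV. g i (t $ i)) \<partial>torus) =
      (\<integral>t. indicator ?C t *\<^sub>R (\<Prod>i\<in>UNIV. g i (t $ i)) \<partial>lebesgue)"
    by (subst integral_restrict_space) auto
  also have "\<dots> = (\<integral>t. (\<Prod>i\<in>UNIV. ?g i (t $ i)) \<partial>lebesgue)"
    by (simp only: e)
  also have "\<dots> = (\<integral>t. (\<Prod>i\<in>UNIV. ?g i (t $ i)) \<partial>lborel)"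
    by (rule integral_completion) (rule borel_measurable_integrable[OF lborel_integral_prod(1)[OF i]])
  finally show ?thesis
    by (simp add: lborel_integral_prod(2)[OF i] set_lebesgue_integral_def)
qed

lemma integral_exp_Icc:
  fixes k a b :: real
  assumes "a \<le> b" "k \<noteq> 0"
  shows "(LINT x:{a..b}|lborel. exp (\<i> * of_real (k * x))) =
    (exp (\<i> * of_real (k * b)) - exp (\<i> * of_real (k * a))) / (\<i> * of_real k)"
proof -
  let ?F = "\<lambda>x::real. exp (\<i> * of_real (k * x)) / (\<i> * of_real k)"
  have "(\<integral>x. indicator {a..b} x *\<^sub>R exp (\<i> * of_real (k * x)) \<partial>lborel) = ?F b - ?F a"
  proof (rule integral_FTC_Icc[OF \<open>a \<le> b\<close>])
    fix x
    define w where "w = \<i> * complex_of_real k"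
    have "w \<noteq> 0" using \<open>k \<noteq> 0\<close> by (simp add: w_def)
    then have "((\<lambda>z. exp (w * z) / w) has_field_derivative exp (w * of_real x)) (at (of_real x))"
      by (auto intro!: derivative_eq_intros)
    from has_vector_derivative_real_field[OF this]
    show "(?F has_vector_derivative exp (\<i> * of_real (k * x))) (at x within {a..b})"
      by (simp add: w_def mult.assoc)
  qed (intro continuous_intros)
  then show ?thesis by (simp add: set_lebesgue_integral_def diff_divide_distrib)
qed

definition phase :: "int ^ 'd::finite \<Rightarrow> real ^ 'd \<Rightarrow> complex" where
  "phase m t = exp (- \<i> * complex_of_real (\<Sum>k\<in>UNIV. t $ k * real_of_int (m $ k)))"

lemma phase_prod: "phase m t = (\<Prod>k\<in>UNIV. exp (\<i> * of_real (- real_of_int (m $ k) * (t $ k))))"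
  unfolding phase_def by (simp add: exp_sum[symmetric] sum_distrib_left sum_negf algebra_simps)

lemma norm_phase [simp]: "cmod (phase m t) = 1"
  unfolding phase_def by (simp add: norm_exp_eq_Re)

lemma phase_measurable [measurable]: "phase m \<in> borel_measurable torus"
  unfolding phase_def
  by (intro continuous_imp_measurable_on_sets_lebesgue continuous_intros) auto

lemma phase_mult_cnj: "phase m t * cnj (phase n t) = phase (m - n) t"
proof -
  have "cnj (phase n t) = exp (\<i> * complex_of_real (\<Sum>k\<in>UNIV. t $ k * real_of_int (n $ k)))"
    unfolding phase_def exp_cnj complex_cnj_mult complex_cnj_minus complex_cnj_i
      complex_cnj_complex_of_real by simp
  moreover have "(\<Sum>k\<in>UNIV. t $ k * real_of_int ((m - n) $ k)) =
      (\<Sum>k\<in>UNIV. t $ k * real_of_int (m $ k)) - (\<Sum>k\<in>UNIV. t $ k * real_of_int (n $ k))"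
    by (simp add: sum_subtractf algebra_simps)
  ultimately show ?thesis unfolding phase_def
    by (simp only: exp_add[symmetric] of_real_diff) (simp add: algebra_simps)
qed

lemma set_integrable_exp: "set_integrable lborel {a..b} (\<lambda>x. exp (\<i> * of_real (k * x)))" for k a b :: real
  by (intro borel_integrable_atLeastAtMost' continuous_intros)

text \<open>The integral factors over coordinates. A factor with nonzero integer frequency vanishes
  because the antiderivative takes equal values at both ends of the period.\<close>

lemma integral_phase:
  "(\<integral>t. phase m t \<partial>(torus :: (real^'d::finite) measure)) = (if m = 0 then of_real ((2 * pi) ^ CARD('d)) else 0)"
proof -
  have 1: "(LINT x:{-pi..pi}|lborel. exp (\<i> * of_real (- real_of_int n * x))) = (if n = 0 then 2 * of_real pi else 0)" for n
  proof (cases "n = 0")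
    case True
    have "(LINT x:{-pi..pi}|lborel. (1::complex)) = 2 * of_real pi"
      by (simp add: set_lebesgue_integral_def scaleR_conv_of_real)
    with True show ?thesis by simp
  next
    case False
    \<comment> \<open>The exponents differ by \<open>- n\<close> full periods.\<close>
    have "exp (\<i> * of_real (- real_of_int n * pi)) = exp (\<i> * of_real (- real_of_int n * - pi))"
      by (subst exp_eq) (rule exI[of _ "- n"], simp add: algebra_simps)
    with False show ?thesis by (subst integral_exp_Icc) auto
  qed
  have "(\<integral>t. phase m t \<partial>(torus :: (real^'d::finite) measure)) =
     (\<Prod>k\<in>UNIV. LINT x:{-pi..pi}|lborel. exp (\<i> * of_real (- real_of_int (m $ k) * x)))"
    unfolding phase_prod by (rule torus_integral_prod) (rule set_integrable_exp)
  also have "\<dots> = (\<Prod>k::'d\<in>UNIV. if m $ k = 0 then 2 * of_real pi else 0)"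
    unfolding 1 by simp
  also have "\<dots> = (if m = 0 then of_real ((2 * pi) ^ CARD('d)) else 0)"
    by (auto simp: vec_eq_iff intro!: prod_zero)
  finally show ?thesis .
qed

section \<open>Fourier coefficients and Bessel's inequality\<close>

lemma finite_measure_torus: "finite_measure (torus :: (real^'d::finite) measure)"
  by (rule finite_measure_lebesgue_on) simp

text \<open>The analysis is done on functions rather than classes modulo null sets;
  \<open>fourier_abs\<close> carries it over to \<open>fourier\<close>.\<close>

definition fcoef :: "(real ^ 'd::finite \<Rightarrow> complex) \<Rightarrow> int ^ 'd \<Rightarrow> complex" where
  "fcoef f m = (\<integral>t. f t * phase m t \<partial>torus)"

lemma integrable_mult_phase:
  assumes "integrable torus f"
  shows "integrable torus (\<lambda>t. f t * phase m t)"
  by (rule Bochner_Integration.integrable_bound[OF assms]) (use assms in \<open>auto simp: norm_mult intro!: borel_measurable_times\<close>)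

lemma fcoef_add:
  assumes "integrable torus f" "integrable torus g"
  shows "fcoef (\<lambda>t. f t + g t) m = fcoef f m + fcoef g m"
  using assms by (simp add: fcoef_def distrib_right integrable_mult_phase)

lemma fcoef_bound:
  assumes "integrable torus f"
  shows "cmod (fcoef f m) \<le> (\<integral>t. cmod (f t) \<partial>torus)"
  unfolding fcoef_def using integral_norm_bound[of torus "\<lambda>t. f t * phase m t"] by (simp add: norm_mult)

text \<open>The integral of \<open>|f - S / V|^2\<close> is nonnegative, where \<open>V\<close> is
  the volume of the torus and \<open>S / V\<close> the Fourier sum over \<open>F\<close>.
  Orthogonality of the characters evaluates it. The transform carries no normalising factor, whence
  the constant \<open>V\<close>.\<close>

lemma bessel:
  fixes f :: "real ^ 'd::finite \<Rightarrow> complex"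
  assumes [measurable]: "f \<in> borel_measurable torus" and sq: "integrable torus (\<lambda>t. (cmod (f t))\<^sup>2)" and "finite F"
  shows "(\<Sum>m\<in>F. (cmod (fcoef f m))\<^sup>2) \<le> (2 * pi) ^ CARD('d) * (\<integral>t. (cmod (f t))\<^sup>2 \<partial>torus)"
proof -
  interpret finite_measure "torus :: (real^'d) measure" by (rule finite_measure_torus)
  let ?V = "(2 * pi) ^ CARD('d)"
  define c where "c = fcoef f"
  define s where "s = (\<Sum>m\<in>F. (cmod (c m))\<^sup>2)"
  define S where "S t = (\<Sum>m\<in>F. c m * cnj (phase m t))" for t
  have V: "?V > 0" by simp
  have i1: "integrable torus (\<lambda>t. (cmod (f t))\<^sup>2 + 1)"
    by (rule Bochner_Integration.integrable_add[OF sq integrable_const])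
  have f: "integrable torus f"
  proof (rule Bochner_Integration.integrable_bound[OF i1 assms(1)], rule AE_I2)
    fix t
    have "0 \<le> (cmod (f t) - 1)\<^sup>2" by simp
    \<comment> \<open>On a finite measure space this makes a square-integrable function
      integrable.\<close>
    then have "2 * cmod (f t) \<le> (cmod (f t))\<^sup>2 + 1" by (simp add: power2_eq_square algebra_simps)
    then have "cmod (f t) \<le> (cmod (f t))\<^sup>2 + 1" using norm_ge_zero[of "f t"] by linarith
    then show "cmod (f t) \<le> norm ((cmod (f t))\<^sup>2 + 1)" by simp
  qed
  have ip: "integrable torus (phase m)" for m :: "int^'d"
    by (rule integrable_const_bound[of _ 1]) simp_all
  have ifp: "integrable torus (\<lambda>t. f t * phase m t)" for m
    by (rule integrable_mult_phase[OF f])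
  have ii: "integrable torus (\<lambda>t. cnj (c m) * (f t * phase m t))" for m
    using ifp by simp
  have iSS: "integrable torus (\<lambda>t. c m * cnj (c n) * phase (n - m) t)" for m n
    using ip by simp
  have e1: "f t * cnj (S t) = (\<Sum>m\<in>F. cnj (c m) * (f t * phase m t))" for t
    by (simp add: S_def sum_distrib_left cnj_sum algebra_simps)
  have e2: "S t * cnj (S t) = (\<Sum>m\<in>F. \<Sum>n\<in>F. c m * cnj (c n) * phase (n - m) t)" for t
  proof -
    have "S t * cnj (S t) = (\<Sum>m\<in>F. \<Sum>n\<in>F. (c m * cnj (phase m t)) * (cnj (c n) * phase n t))"
      by (simp add: S_def sum_product cnj_sum)
    also have "\<dots> = (\<Sum>m\<in>F. \<Sum>n\<in>F. c m * cnj (c n) * (phase n t * cnj (phase m t)))"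
      by (simp only: mult_ac)
    finally show ?thesis by (simp only: phase_mult_cnj)
  qed
  have I1: "(\<integral>t. f t * cnj (S t) \<partial>torus) = of_real s"
  proof -
    have "(\<integral>t. f t * cnj (S t) \<partial>torus) = (\<Sum>m\<in>F. cnj (c m) * (\<integral>t. f t * phase m t \<partial>torus))"
      unfolding e1 by (subst Bochner_Integration.integral_sum[OF ii]) simp
    also have "\<dots> = (\<Sum>m\<in>F. c m * cnj (c m))"
      by (simp add: c_def fcoef_def mult.commute)
    finally show ?thesis by (simp add: s_def complex_norm_square del: of_real_power)
  qed
  have I2: "(\<integral>t. S t * cnj (S t) \<partial>torus) = of_real (?V * s)"
  proof -
    have "(\<integral>t. S t * cnj (S t) \<partial>torus) =
        (\<Sum>m\<in>F. \<Sum>n\<in>F. c m * cnj (c n) * (\<integral>t. phase (n - m) t \<partial>torus))"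
      unfolding e2
      by (subst Bochner_Integration.integral_sum, intro Bochner_Integration.integrable_sum iSS,
          subst Bochner_Integration.integral_sum[OF iSS]) simp
    also have "\<dots> = (\<Sum>m\<in>F. \<Sum>n\<in>F. if n = m then c m * cnj (c n) * of_real ?V else 0)"
      by (intro sum.cong refl) (simp add: integral_phase)
    also have "\<dots> = (\<Sum>m\<in>F. c m * cnj (c m) * of_real ?V)"
      using \<open>finite F\<close> by (simp add: sum.delta)
    also have "\<dots> = of_real ?V * (\<Sum>m\<in>F. of_real ((cmod (c m))\<^sup>2))"
      unfolding sum_distrib_left
      by (intro sum.cong refl) (simp only: complex_norm_square mult.commute)
    finally show ?thesis by (simp add: s_def)
  qed
  have iS2: "integrable torus (\<lambda>t. S t * cnj (S t))"
    unfolding e2 by (intro Bochner_Integration.integrable_sum iSS)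
  have ifS: "integrable torus (\<lambda>t. f t * cnj (S t))"
    unfolding e1 by (intro Bochner_Integration.integrable_sum ii)
  have R: "(cmod (f t - S t / of_real ?V))\<^sup>2 =
      (cmod (f t))\<^sup>2 - 2 / ?V * Re (f t * cnj (S t)) + 1 / ?V\<^sup>2 * Re (S t * cnj (S t))" for t
  proof -
    have *: "(cmod (z - w))\<^sup>2 = (cmod z)\<^sup>2 - 2 * Re (z * cnj w) + (cmod w)\<^sup>2" for z w
      unfolding cmod_power2 by (simp add: power2_eq_square algebra_simps)
    have "(cmod w)\<^sup>2 = Re (w * cnj w)" for w
      unfolding cmod_power2 by (simp add: power2_eq_square)
    then show ?thesis
      unfolding * by (simp add: power2_eq_square Re_divide_of_real norm_divide power_divide)
  qed
  have "0 \<le> (\<integral>t. (cmod (f t - S t / of_real ?V))\<^sup>2 \<partial>torus)"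
    by simp
  also have "\<dots> = (\<integral>t. (cmod (f t))\<^sup>2 \<partial>torus) - 2 / ?V * (\<integral>t. Re (f t * cnj (S t)) \<partial>torus)
      + 1 / ?V\<^sup>2 * (\<integral>t. Re (S t * cnj (S t)) \<partial>torus)"
  proof -
    have j1: "integrable torus (\<lambda>t. 2 / ?V * Re (f t * cnj (S t)))"
      by (rule integrable_mult_right) (rule integrable_Re[OF ifS])
    have j2: "integrable torus (\<lambda>t. 1 / ?V\<^sup>2 * Re (S t * cnj (S t)))"
      by (rule integrable_mult_right) (rule integrable_Re[OF iS2])
    show ?thesis
      unfolding R Bochner_Integration.integral_add[OF Bochner_Integration.integrable_diff[OF sq j1] j2]
        Bochner_Integration.integral_diff[OF sq j1] integral_mult_right_zero ..
  qed
  also have "\<dots> = (\<integral>t. (cmod (f t))\<^sup>2 \<partial>torus) - 2 / ?V * s + 1 / ?V\<^sup>2 * (?V * s)"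
    by (simp only: integral_Re[OF ifS] integral_Re[OF iS2] I1 I2 Re_complex_of_real)
  also have "\<dots> = (\<integral>t. (cmod (f t))\<^sup>2 \<partial>torus) - s / ?V"
    using V by (simp add: field_simps power2_eq_square)
  finally have "s \<le> ?V * (\<integral>t. (cmod (f t))\<^sup>2 \<partial>torus)"
    using V by (simp add: field_simps)
  then show ?thesis by (simp add: s_def c_def)
qed

subsection \<open>Paley's inequality\<close>

text \<open>Telescoping with \<open>1 / (M + 1)^2 <= 1 / M - 1 / (M + 1)\<close> from the first
  admissible index \<open>N\<close> on. The bound is the mass of a tail under the weights
  \<open>1 / k^2\<close>, as the weak type \<open>(1,1)\<close> estimate needs it.\<close>

lemma sum_inverse_squares_ge:
  fixes a :: real
  assumes "a > 0"
  shows "(\<Sum>k | k \<in> {1..n} \<and> a \<le> real k. 1 / (real k)\<^sup>2) \<le> 2 / a"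
proof -
  define N where "N = nat \<lceil>a\<rceil>"
  have N: "N \<ge> 1" "a \<le> real N" using assms by (auto simp: N_def real_nat_ceiling_ge) linarith
  have eq: "{k. k \<in> {1..n} \<and> a \<le> real k} = {N..n}"
  proof -
    have "1 \<le> k" if "a \<le> real k" for k
      using assms that by (cases k) auto
    moreover have "N \<le> k \<longleftrightarrow> a \<le> real k" for k
      by (simp add: N_def nat_le_iff ceiling_le_iff)
    ultimately show ?thesis by auto
  qed
  have step: "(\<Sum>k\<in>{N..N + j}. 1 / (real k)\<^sup>2) \<le> 2 / real N - 1 / real (N + j)" for j
  proof (induction j)
    case 0
    have "1 / (real N)\<^sup>2 \<le> 1 / real N"
      using N(1) by (intro divide_left_mono) (auto simp: power2_eq_square)
    then show ?case by simp
  next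
    case (Suc j)
    define M where "M = real (N + j)"
    have "M > 0" using N by (simp add: M_def)
    then have "1 / (M + 1)\<^sup>2 \<le> 1 / M - 1 / (M + 1)"
    proof -
      have "1 / (M + 1)\<^sup>2 \<le> 1 / (M * (M + 1))"
        using \<open>M > 0\<close> by (intro divide_left_mono mult_pos_pos) (auto simp: power2_eq_square)
      also have "\<dots> = 1 / M - 1 / (M + 1)"
        using \<open>M > 0\<close> by (simp add: field_simps)
      finally show ?thesis .
    qed
    with Suc show ?case by (simp add: M_def algebra_simps)
  qed
  have "(\<Sum>k\<in>{N..n}. 1 / (real k)\<^sup>2) \<le> 2 / real N"
  proof (cases "N \<le> n")
    case True
    then obtain j where n: "n = N + j" using le_Suc_ex by blast
    have "1 / real (N + j) \<ge> 0" by simp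
    then show ?thesis unfolding n using step[of j] by linarith
  qed simp
  also have "\<dots> \<le> 2 / a" using N assms by (intro divide_left_mono) auto
  finally show ?thesis by (simp only: eq)
qed

text \<open>
  The sum on the left is the mass, for the weights \<open>1/k\<^sup>2\<close>, of the set where
  \<open>k |c(\<sigma> k)| \<ge> 2 r\<close>; \<open>f\<close> is cut at height \<open>r\<close>, the large part being estimated in \<open>L\<^sup>1\<close> and the small
  part in \<open>L\<^sup>2\<close>.
\<close>

lemma fcoef_weak_type:
  fixes f :: "real ^ 'd::finite \<Rightarrow> complex"
  assumes f: "integrable torus f" and \<sigma>: "inj_on \<sigma> {1..n}" and "r > 0"
  shows "ennreal (\<Sum>k | k \<in> {1..n} \<and> 2 * r \<le> real k * cmod (fcoef f (\<sigma> k)). 1 / (real k)\<^sup>2) \<le>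
    (\<integral>\<^sup>+t. ennreal (2 / r * (if r < cmod (f t) then cmod (f t) else 0) +
       (2 * pi) ^ CARD('d) / r\<^sup>2 * (if r < cmod (f t) then 0 else (cmod (f t))\<^sup>2)) \<partial>torus)"
proof -
  interpret finite_measure "torus :: (real^'d) measure" by (rule finite_measure_torus)
  let ?V = "(2 * pi) ^ CARD('d)"
  define g where "g t = (if r < cmod (f t) then f t else 0)" for t
  define h where "h t = (if r < cmod (f t) then 0 else f t)" for t
  have [measurable]: "f \<in> borel_measurable torus" using f by simp
  have [measurable]: "g \<in> borel_measurable torus" "h \<in> borel_measurable torus"
    unfolding g_def h_def by measurable
  have g: "integrable torus g" and h: "integrable torus h"
    by (rule Bochner_Integration.integrable_bound[OF f]; simp add: g_def h_def)+
  have h2: "integrable torus (\<lambda>t. (cmod (h t))\<^sup>2)"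
    by (rule integrable_const_bound[of _ "r\<^sup>2"]) (use \<open>r > 0\<close> in \<open>auto simp: h_def intro!: power_mono\<close>)
  have fgh: "fcoef f m = fcoef g m + fcoef h m" for m
    by (subst fcoef_add[OF g h, symmetric]) (auto simp: g_def h_def intro!: arg_cong[of _ _ "\<lambda>f. fcoef f m"])
  define A where "A = (\<integral>t. cmod (g t) \<partial>torus)"
  define B where "B = (\<integral>t. (cmod (h t))\<^sup>2 \<partial>torus)"
  let ?S = "{k. k \<in> {1..n} \<and> 2 * r \<le> real k * cmod (fcoef f (\<sigma> k))}"
  let ?S1 = "{k. k \<in> {1..n} \<and> r \<le> real k * A}"
  let ?S2 = "{k. k \<in> {1..n} \<and> r \<le> real k * cmod (fcoef h (\<sigma> k))}"
  have "A \<ge> 0" by (simp add: A_def)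
  \<comment> \<open>If the sum of two terms reaches \<open>2 * r\<close>, one of them reaches
    \<open>r\<close>. Every coefficient of the large part is at most its \<open>L^1\<close> norm
    \<open>A\<close>, so \<open>?S1\<close> is a tail of indices.\<close>
  have "?S \<subseteq> ?S1 \<union> ?S2"
  proof
    fix k assume k: "k \<in> ?S"
    have "cmod (fcoef f (\<sigma> k)) \<le> A + cmod (fcoef h (\<sigma> k))"
      unfolding fgh A_def using fcoef_bound[OF g, of "\<sigma> k"] norm_triangle_ineq[of "fcoef g (\<sigma> k)" "fcoef h (\<sigma> k)"]
      by linarith
    then have "real k * cmod (fcoef f (\<sigma> k)) \<le> real k * A + real k * cmod (fcoef h (\<sigma> k))"
      by (metis distrib_left mult_left_mono of_nat_0_le_iff)
    then have "r \<le> real k * A \<or> r \<le> real k * cmod (fcoef h (\<sigma> k))"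
      using k by auto
    then show "k \<in> ?S1 \<union> ?S2" using k by auto
  qed
  then have "(\<Sum>k\<in>?S. 1 / (real k)\<^sup>2) \<le> (\<Sum>k\<in>?S1 \<union> ?S2. 1 / (real k)\<^sup>2)"
    by (intro sum_mono2) auto
  also have "\<dots> \<le> (\<Sum>k\<in>?S1. 1 / (real k)\<^sup>2) + (\<Sum>k\<in>?S2. 1 / (real k)\<^sup>2)"
    by (subst sum_Un) (auto intro!: sum_nonneg)
  also have "(\<Sum>k\<in>?S1. 1 / (real k)\<^sup>2) \<le> 2 / r * A"
  proof (cases "A = 0")
    case True
    then show ?thesis using \<open>r > 0\<close> by simp
  next
    case False
    then have "A > 0" using \<open>A \<ge> 0\<close> by simp
    then have "?S1 = {k. k \<in> {1..n} \<and> r / A \<le> real k}" by (simp add: field_simps)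
    then show ?thesis using sum_inverse_squares_ge[of "r / A" n] \<open>A > 0\<close> \<open>r > 0\<close> by simp
  qed
  \<comment> \<open>Chebyshev's inequality for the small part. Injectivity of
    \<open>\<sigma>\<close> then turns the sum over \<open>k\<close> into one over distinct
    frequencies, to which Bessel applies.\<close>
  also have "(\<Sum>k\<in>?S2. 1 / (real k)\<^sup>2) \<le> (\<Sum>k\<in>?S2. (cmod (fcoef h (\<sigma> k)))\<^sup>2 / r\<^sup>2)"
  proof (rule sum_mono)
    fix k assume "k \<in> ?S2"
    then have "k \<ge> 1" and "r\<^sup>2 \<le> (real k * cmod (fcoef h (\<sigma> k)))\<^sup>2"
      using \<open>r > 0\<close> by (auto intro!: power_mono)
    then show "1 / (real k)\<^sup>2 \<le> (cmod (fcoef h (\<sigma> k)))\<^sup>2 / r\<^sup>2"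
      using \<open>r > 0\<close> by (simp add: divide_simps power_mult_distrib mult.commute)
  qed
  also have "(\<Sum>k\<in>?S2. (cmod (fcoef h (\<sigma> k)))\<^sup>2 / r\<^sup>2) = (\<Sum>m\<in>\<sigma> ` ?S2. (cmod (fcoef h m))\<^sup>2) / r\<^sup>2"
    unfolding sum_divide_distrib
    by (subst sum.reindex[OF inj_on_subset[OF \<sigma>]]) auto
  also have "\<dots> \<le> ?V * B / r\<^sup>2"
    unfolding B_def by (intro divide_right_mono bessel h2) auto
  finally have "(\<Sum>k\<in>?S. 1 / (real k)\<^sup>2) \<le> 2 / r * A + ?V / r\<^sup>2 * B"
    by simp
  also have "\<dots> = (\<integral>t. 2 / r * cmod (g t) + ?V / r\<^sup>2 * (cmod (h t))\<^sup>2 \<partial>torus)"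
    unfolding A_def B_def using g h2 by simp
  finally have "ennreal (\<Sum>k\<in>?S. 1 / (real k)\<^sup>2) \<le>
      ennreal (\<integral>t. 2 / r * cmod (g t) + ?V / r\<^sup>2 * (cmod (h t))\<^sup>2 \<partial>torus)"
    by (rule ennreal_leI)
  also have "\<dots> = (\<integral>\<^sup>+t. ennreal (2 / r * cmod (g t) + ?V / r\<^sup>2 * (cmod (h t))\<^sup>2) \<partial>torus)"
    using g h2 \<open>r > 0\<close> by (subst nn_integral_eq_integral) auto
  also have "\<dots> = (\<integral>\<^sup>+t. ennreal (2 / r * (if r < cmod (f t) then cmod (f t) else 0) +
       ?V / r\<^sup>2 * (if r < cmod (f t) then 0 else (cmod (f t))\<^sup>2)) \<partial>torus)"
    by (intro nn_integral_cong) (simp add: g_def h_def)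
  finally show ?thesis .
qed

section \<open>Marcinkiewicz interpolation\<close>

lemma nn_integral_powr_from_0:
  fixes a c :: real
  assumes "a > -1" "c \<ge> 0"
  shows "(\<integral>\<^sup>+x. ennreal (x powr a) * indicator {0..c} x \<partial>lborel) = ennreal (c powr (a + 1) / (a + 1))"
  using has_integral_powr_from_0[OF assms] by (intro nn_integral_has_integral_lebesgue') auto

lemma nn_integral_powr_to_inf:
  fixes e a :: real
  assumes "e < -1" "a > 0"
  shows "(\<integral>\<^sup>+x. ennreal (x powr e) * indicator {a..} x \<partial>lborel) = ennreal (- (a powr (e + 1)) / (e + 1))"
  using has_integral_powr_to_inf[OF assms] by (intro nn_integral_has_integral_lebesgue') auto

text \<open>This integrates the weak type bound over all heights \<open>r\<close> at a point where
  \<open>|f|\<close> equals \<open>y\<close>. The large part gives \<open>r powr (p - 2)\<close> on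
  \<open>0 < r < y\<close>, integrable at 0 since \<open>p > 1\<close>; the small part gives
  \<open>r powr (p - 3)\<close> on \<open>r >= y\<close>, integrable at infinity since
  \<open>p < 2\<close>.\<close>

lemma marcinkiewicz_kernel:
  fixes p V y :: real
  assumes p: "1 < p" "p < 2" and "V \<ge> 0" "y \<ge> 0"
  shows "(\<integral>\<^sup>+r. ennreal (if r > 0 then p * r powr (p - 1) *
      (2 / r * (if r < y then y else 0) + V / r\<^sup>2 * (if r < y then 0 else y\<^sup>2)) else 0) \<partial>lborel)
    \<le> ennreal (p * (2 / (p - 1) + V / (2 - p)) * y powr p)"
    (is "?L \<le> _")
proof (cases "y = 0")
  case True
  then have "?L = (\<integral>\<^sup>+r. 0 \<partial>(lborel :: real measure))"
    by (intro nn_integral_cong) auto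
  then show ?thesis by simp
next
  case False
  then have y: "y > 0" using \<open>y \<ge> 0\<close> by simp
  have "?L \<le> (\<integral>\<^sup>+r. ennreal (2 * p * y) * (ennreal (r powr (p - 2)) * indicator {0..y} r) +
      ennreal (p * V * y\<^sup>2) * (ennreal (r powr (p - 3)) * indicator {y..} r) \<partial>lborel)"
  proof (rule nn_integral_mono)
    fix r :: real
    have 1: "r powr (p - 1) / r = r powr (p - 2)" "r powr (p - 1) / r\<^sup>2 = r powr (p - 3)" if "r > 0"
    proof -
      have "r powr (p - 1) / r powr 1 = r powr (p - 2)" "r powr (p - 1) / r powr 2 = r powr (p - 3)"
        by (simp_all only: powr_diff[symmetric]) simp_all
      then show "r powr (p - 1) / r = r powr (p - 2)" "r powr (p - 1) / r\<^sup>2 = r powr (p - 3)"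
        using that by simp_all
    qed
    consider "r \<le> 0" | "0 < r" "r < y" | "0 < r" "y \<le> r" by linarith
    then show "ennreal (if r > 0 then p * r powr (p - 1) *
      (2 / r * (if r < y then y else 0) + V / r\<^sup>2 * (if r < y then 0 else y\<^sup>2)) else 0) \<le>
      ennreal (2 * p * y) * (ennreal (r powr (p - 2)) * indicator {0..y} r) +
      ennreal (p * V * y\<^sup>2) * (ennreal (r powr (p - 3)) * indicator {y..} r)"
    proof cases
      case 1
      then show ?thesis by simp
    next
      case 2
      then have "p * r powr (p - 1) * (2 / r * y) = 2 * p * y * r powr (p - 2)"
        unfolding 1(1)[OF 2(1), symmetric] by simp
      with 2 p y show ?thesis by (simp add: ennreal_mult' [symmetric])
    next
      case 3
      then have "p * r powr (p - 1) * (V / r\<^sup>2 * y\<^sup>2) = p * V * y\<^sup>2 * r powr (p - 3)"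
        unfolding 1(2)[OF 3(1), symmetric] by simp
      with 3 p y \<open>V \<ge> 0\<close> show ?thesis by (simp add: ennreal_mult' [symmetric])
    qed
  qed
  also have "\<dots> = ennreal (2 * p * y) * ennreal (y powr (p - 1) / (p - 1)) +
      ennreal (p * V * y\<^sup>2) * ennreal (y powr (p - 2) / (2 - p))"
  proof -
    have "- (y powr (p - 3 + 1)) / (p - 3 + 1) = y powr (p - 2) / (2 - p)"
      using p by (simp add: divide_simps) (simp add: algebra_simps)
    then show ?thesis
      using nn_integral_powr_from_0[of "p - 2" y] nn_integral_powr_to_inf[of "p - 3" y] p y
      by (subst nn_integral_add) (auto simp: nn_integral_cmult)
  qed
  also have "\<dots> = ennreal (2 * p * y * (y powr (p - 1) / (p - 1)) + p * V * y\<^sup>2 * (y powr (p - 2) / (2 - p)))"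
    using p y \<open>V \<ge> 0\<close> by (simp add: ennreal_mult'[symmetric] ennreal_plus[symmetric] del: ennreal_plus)
  also have "2 * p * y * (y powr (p - 1) / (p - 1)) + p * V * y\<^sup>2 * (y powr (p - 2) / (2 - p)) =
      p * (2 / (p - 1) + V / (2 - p)) * y powr p"
  proof -
    have "y powr 1 * y powr (p - 1) = y powr p" "y powr 2 * y powr (p - 2) = y powr p"
      by (simp_all only: powr_add[symmetric]) simp_all
    then have *: "y * y powr (p - 1) = y powr p" "y\<^sup>2 * y powr (p - 2) = y powr p"
      using y by simp_all
    have "2 * p * y * (y powr (p - 1) / (p - 1)) = 2 * p * (y * y powr (p - 1)) / (p - 1)"
      "p * V * y\<^sup>2 * (y powr (p - 2) / (2 - p)) = p * V * (y\<^sup>2 * y powr (p - 2)) / (2 - p)"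
      by simp_all
    moreover have "p * (2 / (p - 1) + V / (2 - p)) * y powr p = 2 * p * y powr p / (p - 1) + p * V * y powr p / (2 - p)"
      by (simp add: distrib_left distrib_right)
    ultimately show ?thesis by (simp only: *)
  qed
  finally show ?thesis .
qed

text \<open>Layer-cake formula: \<open>x k powr p\<close> is the integral of
  \<open>p * r powr (p - 1)\<close> over \<open>0 <= r <= x k\<close>. After summation against
  \<open>1 / k^2\<close> the weak type bound applies at each height, and exchanging the integrals
  leaves the kernel estimate. The constant does not depend on \<open>\<sigma>\<close> or
  \<open>n\<close>.\<close>

lemma paley_enumerated:
  fixes f :: "real ^ 'd::finite \<Rightarrow> complex" and p :: real
  assumes p: "1 < p" "p < 2" and f: "integrable torus f"
    and fp: "integrable torus (\<lambda>t. cmod (f t) powr p)" and \<sigma>: "inj_on \<sigma> {1..n}"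
  shows "(\<Sum>k\<in>{1..n}. real k powr (p - 2) * cmod (fcoef f (\<sigma> k)) powr p) \<le>
    2 powr p * (p * (2 / (p - 1) + (2 * pi) ^ CARD('d) / (2 - p))) * (\<integral>t. cmod (f t) powr p \<partial>torus)"
proof -
  interpret finite_measure "torus :: (real^'d) measure" by (rule finite_measure_torus)
  interpret pair_sigma_finite "lborel :: real measure" "torus :: (real^'d) measure" ..
  let ?V = "(2 * pi) ^ CARD('d) :: real"
  let ?C = "p * (2 / (p - 1) + ?V / (2 - p))"
  have [measurable]: "f \<in> borel_measurable torus" using f by simp
  \<comment> \<open>Halving makes \<open>r <= x k\<close> the level condition of
    \<open>fcoef_weak_type\<close>; it costs the factor \<open>2 powr p\<close> at the end.\<close>
  define x where "x k = real k * cmod (fcoef f (\<sigma> k)) / 2" for k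
  have x0: "x k \<ge> 0" for k by (simp add: x_def)
  define K where "K r y = (if r > 0 then p * r powr (p - 1) *
      (2 / r * (if r < y then y else 0) + ?V / r\<^sup>2 * (if r < y then 0 else y\<^sup>2)) else 0)" for r y :: real
  have powr_int: "ennreal (x k powr p) = (\<integral>\<^sup>+r. ennreal p * (ennreal (r powr (p - 1)) * indicator {0..x k} r) \<partial>lborel)" for k
    using nn_integral_powr_from_0[of "p - 1" "x k"] p x0[of k]
    by (subst nn_integral_cmult) (auto simp: ennreal_mult'[symmetric])
  have "ennreal (\<Sum>k\<in>{1..n}. 1 / (real k)\<^sup>2 * x k powr p) = (\<Sum>k\<in>{1..n}. ennreal (1 / (real k)\<^sup>2) * ennreal (x k powr p))"
    by (subst sum_ennreal[symmetric]) (auto simp: ennreal_mult'[symmetric])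
  also have "\<dots> = (\<integral>\<^sup>+r. (\<Sum>k\<in>{1..n}. ennreal (1 / (real k)\<^sup>2) *
      (ennreal p * (ennreal (r powr (p - 1)) * indicator {0..x k} r))) \<partial>lborel)"
    unfolding powr_int by (subst nn_integral_sum) (auto simp: nn_integral_cmult)
  also have "\<dots> \<le> (\<integral>\<^sup>+r. (\<integral>\<^sup>+t. ennreal (K r (cmod (f t))) \<partial>torus) \<partial>lborel)"
  proof (rule nn_integral_mono)
    fix r :: real
    show "(\<Sum>k\<in>{1..n}. ennreal (1 / (real k)\<^sup>2) *
      (ennreal p * (ennreal (r powr (p - 1)) * indicator {0..x k} r))) \<le> (\<integral>\<^sup>+t. ennreal (K r (cmod (f t))) \<partial>torus)"
    proof (cases "r > 0")
      case False
      \<comment> \<open>At \<open>r = 0\<close> the power is zero by the convention for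
        \<open>powr\<close>; for negative \<open>r\<close> the indicator is zero.\<close>
      then have "ennreal (r powr (p - 1)) * indicator {0..x k} r = 0" for k
        by (cases "r = 0") auto
      then show ?thesis by (simp only: mult_zero_right sum.neutral_const) simp
    next
      case True
      let ?P = "p * r powr (p - 1)"
      have P: "?P \<ge> 0" using p by simp
      have "(\<Sum>k\<in>{1..n}. ennreal (1 / (real k)\<^sup>2) * (ennreal p * (ennreal (r powr (p - 1)) * indicator {0..x k} r))) =
        (\<Sum>k\<in>{1..n}. if 2 * r \<le> real k * cmod (fcoef f (\<sigma> k)) then ennreal (?P * (1 / (real k)\<^sup>2)) else 0)"
        using True p by (intro sum.cong refl) (auto simp: x_def indicator_def ennreal_mult'[symmetric] mult_ac)
      also have "\<dots> = (\<Sum>k | k \<in> {1..n} \<and> 2 * r \<le> real k * cmod (fcoef f (\<sigma> k)). ennreal (?P * (1 / (real k)\<^sup>2)))"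
        by (subst sum.inter_filter[symmetric]) auto
      also have "\<dots> = ennreal ?P * ennreal (\<Sum>k | k \<in> {1..n} \<and> 2 * r \<le> real k * cmod (fcoef f (\<sigma> k)). 1 / (real k)\<^sup>2)"
        using P by (simp add: sum_ennreal ennreal_mult[symmetric] sum_nonneg sum_distrib_left del: times_divide_eq_right)
      also have "\<dots> \<le> ennreal ?P * (\<integral>\<^sup>+t. ennreal (2 / r * (if r < cmod (f t) then cmod (f t) else 0) +
          ?V / r\<^sup>2 * (if r < cmod (f t) then 0 else (cmod (f t))\<^sup>2)) \<partial>torus)"
        by (intro mult_left_mono fcoef_weak_type f \<sigma> True) simp
      also have "\<dots> = (\<integral>\<^sup>+t. ennreal (K r (cmod (f t))) \<partial>torus)"
        by (subst nn_integral_cmult[symmetric], measurable)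
          (simp only: K_def True if_True ennreal_mult'[OF P, symmetric])
      finally show ?thesis .
    qed
  qed
  also have "\<dots> = (\<integral>\<^sup>+t. (\<integral>\<^sup>+r. ennreal (K r (cmod (f t))) \<partial>lborel) \<partial>torus)"
    by (rule Fubini'[symmetric]) (unfold K_def, measurable)
  also have "\<dots> \<le> (\<integral>\<^sup>+t. ennreal (?C * cmod (f t) powr p) \<partial>torus)"
    unfolding K_def by (intro nn_integral_mono marcinkiewicz_kernel p) auto
  also have "\<dots> = ennreal (?C * (\<integral>t. cmod (f t) powr p \<partial>torus))"
    using p fp by (subst nn_integral_eq_integral) auto
  finally have *: "(\<Sum>k\<in>{1..n}. 1 / (real k)\<^sup>2 * x k powr p) \<le> ?C * (\<integral>t. cmod (f t) powr p \<partial>torus)"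
    using p by (subst (asm) ennreal_le_iff) (auto intro!: mult_nonneg_nonneg add_nonneg_nonneg)
  have "(\<Sum>k\<in>{1..n}. real k powr (p - 2) * cmod (fcoef f (\<sigma> k)) powr p) =
    (\<Sum>k\<in>{1..n}. 2 powr p * (1 / (real k)\<^sup>2 * x k powr p))"
  proof (rule sum.cong[OF refl])
    fix k assume "k \<in> {1..n}"
    then have k: "real k > 0" by simp
    have "real k powr (p - 2) = real k powr p / (real k)\<^sup>2"
      using k by (simp add: powr_diff)
    then show "real k powr (p - 2) * cmod (fcoef f (\<sigma> k)) powr p = 2 powr p * (1 / (real k)\<^sup>2 * x k powr p)"
      by (simp add: x_def powr_divide powr_mult)
  qed
  also have "\<dots> = 2 powr p * (\<Sum>k\<in>{1..n}. 1 / (real k)\<^sup>2 * x k powr p)"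
    by (simp only: sum_distrib_left)
  also have "\<dots> \<le> 2 powr p * (?C * (\<integral>t. cmod (f t) powr p \<partial>torus))"
    using * by (intro mult_left_mono) auto
  finally show ?thesis by (simp only: mult.assoc)
qed

subsection \<open>Rearrangements\<close>

text \<open>Any bound of \<open>|c|\<close> belongs to the set, so the infimum in
  \<open>rearr\<close> is a genuine one. For \<open>k = 0\<close> the set would be empty.\<close>

lemma rearr_set_nonempty:
  fixes c :: "'i \<Rightarrow> complex"
  assumes "bounded (range c)" "k \<ge> 1"
  shows "{t. 0 \<le> t \<and> finite {m. t < cmod (c m)} \<and> card {m. t < cmod (c m)} < k} \<noteq> {}"
proof -
  obtain B where B: "cmod (c m) \<le> B" for m
    using assms(1) by (auto simp: bounded_iff)
  have "0 \<le> B" using order_trans[OF norm_ge_zero B] .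
  moreover have "{m. B < cmod (c m)} = {}" using B by (auto simp: not_less)
  ultimately have "B \<in> {t. 0 \<le> t \<and> finite {m. t < cmod (c m)} \<and> card {m. t < cmod (c m)} < k}"
    using assms(2) by auto
  then show ?thesis by blast
qed

lemma rearr_nonneg:
  assumes "bounded (range c)" "k \<ge> 1"
  shows "0 \<le> rearr c k"
  unfolding rearr_def by (rule cInf_greatest[OF rearr_set_nonempty[OF assms]]) auto

text \<open>A threshold below \<open>b\<close> has all of \<open>F\<close>, hence at least
  \<open>k\<close> points, above it and so does not compete in the infimum.\<close>

lemma rearr_ge:
  assumes "bounded (range c)" "k \<ge> 1" and F: "finite F" "k \<le> card F" "\<And>m. m \<in> F \<Longrightarrow> b \<le> cmod (c m)"
  shows "b \<le> rearr c k"
  unfolding rearr_def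
proof (rule cInf_greatest[OF rearr_set_nonempty[OF assms(1,2)]])
  fix t assume t: "t \<in> {t. 0 \<le> t \<and> finite {m. t < cmod (c m)} \<and> card {m. t < cmod (c m)} < k}"
  show "b \<le> t"
  proof (rule ccontr)
    assume "\<not> b \<le> t"
    with F(3) have "F \<subseteq> {m. t < cmod (c m)}" by force
    then have "card F \<le> card {m. t < cmod (c m)}" using t by (intro card_mono) auto
    with t F(2) show False by auto
  qed
qed

text \<open>A nonnegative \<open>s\<close> below the infimum is not an admissible threshold, so
  infinitely many or at least \<open>k\<close> points exceed it. The alternative
  \<open>s <= 0\<close> covers a vanishing rearrangement, where any \<open>k\<close> indices will
  do.\<close>

lemma less_rearrD:
  fixes c :: "'i \<Rightarrow> complex"
  assumes inf: "infinite (UNIV :: 'i set)" and s: "s \<le> 0 \<or> s < rearr c k"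
  shows "\<exists>F. finite F \<and> card F = k \<and> (\<forall>m\<in>F. s \<le> cmod (c m))"
proof (cases "s \<le> 0")
  case True
  obtain F :: "'i set" where "finite F" "card F = k"
    using infinite_arbitrarily_large[OF inf] by blast
  moreover have "s \<le> cmod (c m)" for m using True norm_ge_zero[of "c m"] by linarith
  ultimately show ?thesis by blast
next
  case False
  let ?T = "{t. 0 \<le> t \<and> finite {m. t < cmod (c m)} \<and> card {m. t < cmod (c m)} < k}"
  have "s \<notin> ?T"
  proof
    assume "s \<in> ?T"
    then have "rearr c k \<le> s"
      unfolding rearr_def by (rule cInf_lower) (auto intro: bdd_belowI[of _ 0])
    with False s show False by simp
  qed
  then have *: "infinite {m. s < cmod (c m)} \<or> k \<le> card {m. s < cmod (c m)}"
    using False by auto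
  have "\<exists>F. finite F \<and> card F = k \<and> F \<subseteq> {m. s < cmod (c m)}"
    using *
  proof
    assume "infinite {m. s < cmod (c m)}"
    then show ?thesis using infinite_arbitrarily_large[of "{m. s < cmod (c m)}" k] by blast
  next
    assume "k \<le> card {m. s < cmod (c m)}"
    from obtain_subset_with_card_n[OF this] show ?thesis by blast
  qed
  then obtain F where F: "finite F" "card F = k" "F \<subseteq> {m. s < cmod (c m)}" by blast
  have "\<forall>m\<in>F. s \<le> cmod (c m)" using F(3) by (auto intro: less_imp_le)
  with F show ?thesis by blast
qed

text \<open>Greedy selection: index \<open>n + 1\<close> has \<open>n + 1\<close> candidates, of
  which at most \<open>n\<close> are already taken.\<close>

lemma injective_choice:
  fixes P :: "nat \<Rightarrow> 'i \<Rightarrow> bool"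
  assumes "\<And>k. k \<in> {1..n} \<Longrightarrow> \<exists>F. finite F \<and> card F = k \<and> (\<forall>m\<in>F. P k m)"
  shows "\<exists>\<sigma>. inj_on \<sigma> {1..n} \<and> (\<forall>k\<in>{1..n}. P k (\<sigma> k))"
  using assms
proof (induction n)
  case (Suc n)
  have "\<exists>F. finite F \<and> card F = k \<and> (\<forall>m\<in>F. P k m)" if "k \<in> {1..n}" for k
    using that by (intro Suc.prems) auto
  from Suc.IH[OF this] obtain \<sigma> where \<sigma>: "inj_on \<sigma> {1..n}" "\<forall>k\<in>{1..n}. P k (\<sigma> k)"
    by blast
  have "\<exists>F. finite F \<and> card F = Suc n \<and> (\<forall>m\<in>F. P (Suc n) m)"
    by (rule Suc.prems) simp
  then obtain F where F: "finite F" "card F = Suc n" "\<forall>m\<in>F. P (Suc n) m" by blast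
  have "card (\<sigma> ` {1..n}) \<le> n" using card_image_le[of "{1..n}" \<sigma>] by simp
  then have "\<not> F \<subseteq> \<sigma> ` {1..n}"
    using F(2) card_mono[of "\<sigma> ` {1..n}" F] by auto
  then obtain m where m: "m \<in> F" "m \<notin> \<sigma> ` {1..n}" by blast
  have I: "{1..Suc n} = insert (Suc n) {1..n}" by (rule atLeastAtMostSuc_conv) simp
  have n: "Suc n \<notin> {1..n}" by simp
  have "inj_on (\<sigma>(Suc n := m)) {1..Suc n}"
    unfolding I inj_on_insert using inj_on_fun_updI[OF \<sigma>(1) m(2), of "Suc n"] m(2) n
    by (auto simp: fun_upd_image)
  moreover have "P k ((\<sigma>(Suc n := m)) k)" if "k \<in> {1..Suc n}" for k
  proof (cases "k = Suc n")
    case True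
    then show ?thesis using F(3) m(1) by simp
  next
    case False
    then show ?thesis using \<sigma>(2) that by simp
  qed
  ultimately show ?case by blast
qed simp

text \<open>
  Fewer than \<open>k\<close> points may satisfy \<open>|c| \<ge> c\<^sub>k\<^sup>*\<close>, for example when \<open>|c|\<close> increases to its
  supremum; hence the detour through a factor \<open>y < 1\<close>.
\<close>

lemma sum_rearr_le:
  fixes c :: "'i \<Rightarrow> complex" and w :: "nat \<Rightarrow> real"
  assumes inf: "infinite (UNIV :: 'i set)" and c: "bounded (range c)" and p: "p > 0" and w: "\<And>k. w k \<ge> 0"
    and bound: "\<And>\<sigma>. inj_on \<sigma> {1..n} \<Longrightarrow> (\<Sum>k\<in>{1..n}. w k * cmod (c (\<sigma> k)) powr p) \<le> C"
  shows "(\<Sum>k\<in>{1..n}. w k * rearr c k powr p) \<le> C"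
proof (rule field_le_mult_one_interval)
  fix z :: real assume z: "0 < z" "z < 1"
  \<comment> \<open>Chosen so that \<open>y powr p = z\<close>: shrinking the rearrangement by
    \<open>y\<close> multiplies the sum by \<open>z\<close>, which is arbitrarily close to
    1.\<close>
  define y where "y = z powr (1 / p)"
  have y: "0 < y" "y < 1" "y powr p = z"
    using z p powr_less_mono2[of "1 / p" z 1] by (auto simp: y_def powr_powr)
  have r0: "rearr c k \<ge> 0" if "k \<in> {1..n}" for k
    using rearr_nonneg[OF c] that by auto
  have "\<exists>\<sigma>. inj_on \<sigma> {1..n} \<and> (\<forall>k\<in>{1..n}. y * rearr c k \<le> cmod (c (\<sigma> k)))"
  proof (rule injective_choice[where P = "\<lambda>k m. y * rearr c k \<le> cmod (c m)"], rule less_rearrD[OF inf])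
    fix k assume "k \<in> {1..n}"
    from r0[OF this] y show "y * rearr c k \<le> 0 \<or> y * rearr c k < rearr c k"
      by (cases "rearr c k = 0") auto
  qed
  then obtain \<sigma> where \<sigma>: "inj_on \<sigma> {1..n}" "\<And>k. k \<in> {1..n} \<Longrightarrow> y * rearr c k \<le> cmod (c (\<sigma> k))"
    by blast
  have "z * (\<Sum>k\<in>{1..n}. w k * rearr c k powr p) = (\<Sum>k\<in>{1..n}. w k * (y * rearr c k) powr p)"
    unfolding sum_distrib_left by (intro sum.cong refl) (use y r0 in \<open>auto simp: powr_mult\<close>)
  also have "\<dots> \<le> (\<Sum>k\<in>{1..n}. w k * cmod (c (\<sigma> k)) powr p)"
    using y r0 p by (intro sum_mono mult_left_mono powr_mono2 \<sigma>(2) w) auto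
  also have "\<dots> \<le> C" by (rule bound[OF \<sigma>(1)])
  finally show "z * (\<Sum>k\<in>{1..n}. w k * rearr c k powr p) \<le> C" .
qed

section \<open>Lorentz sums for conjugate exponents\<close>

lemma lorentz_term_conjugate:
  fixes p q :: real
  assumes "1 < p" "1 / p + 1 / q = 1" "bounded (range c)"
  shows "lorentz_term q p c k = real (Suc k) powr (p - 2) * rearr c (Suc k) powr p"
proof -
  \<comment> \<open>Conjugacy turns the Lorentz weight into the weight of Paley's
    inequality.\<close>
  have "(1 / q - 1 / p) * p = p - 2"
  proof -
    have q: "1 / q = 1 - 1 / p" using assms(2) by simp
    show ?thesis unfolding q using assms(1) by (simp add: field_simps)
  qed
  then show ?thesis
    unfolding lorentz_term_def using rearr_nonneg[OF assms(3), of "Suc k"]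
    by (simp add: powr_mult powr_powr)
qed

lemma lorentz_term_nonneg: "0 \<le> lorentz_term q p c k"
  by (simp add: lorentz_term_def)

lemma lorentz_bound:
  fixes c :: "'i \<Rightarrow> complex" and p q :: real
  assumes inf: "infinite (UNIV :: 'i set)" and c: "bounded (range c)" and pq: "1 < p" "1 / p + 1 / q = 1"
    and bound: "\<And>n \<sigma>. inj_on \<sigma> {1..n} \<Longrightarrow> (\<Sum>k\<in>{1..n}. real k powr (p - 2) * cmod (c (\<sigma> k)) powr p) \<le> C"
  shows "summable (lorentz_term q p c)" "(\<Sum>k. lorentz_term q p c k) \<le> C"
proof -
  have *: "(\<Sum>k<n. lorentz_term q p c k) \<le> C" for n
  proof -
    have "(\<Sum>k<n. lorentz_term q p c k) = (\<Sum>k\<in>{1..n}. real k powr (p - 2) * rearr c k powr p)"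
      unfolding lorentz_term_conjugate[OF pq c] by (simp add: sum.atLeast1_atMost_eq)
    also have "\<dots> \<le> C"
      using pq by (intro sum_rearr_le[OF inf c] bound) auto
    finally show ?thesis .
  qed
  show "summable (lorentz_term q p c)"
    by (rule summableI_nonneg_bounded[OF lorentz_term_nonneg *])
  then show "(\<Sum>k. lorentz_term q p c k) \<le> C"
    by (rule suminf_le_const) (rule *)
qed

text \<open>For \<open>2 ^ j <= k < 2 ^ Suc j\<close> the set for \<open>j\<close> has at least
  \<open>k\<close> points, so \<open>rearr c k\<close> is at least \<open>b j\<close>. The block has
  \<open>2 ^ j\<close> terms of weight at least \<open>(2 ^ Suc j) powr (p - 2)\<close>; the factor
  2 comes from \<open>2 powr (p - 2) >= 1 / 2\<close>. Sets for different \<open>j\<close> may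
  overlap, as each serves its own block only.\<close>

lemma dyadic_le_lorentz:
  fixes c :: "'i \<Rightarrow> complex" and p q :: real
  assumes c: "bounded (range c)" and p: "1 < p" "p < 2" and pq: "1 / p + 1 / q = 1"
    and sum: "summable (lorentz_term q p c)"
    and b: "\<And>j. b j \<ge> 0"
    and F: "\<And>j. \<exists>F. finite F \<and> 2 ^ Suc j \<le> card F \<and> (\<forall>m\<in>F. b j \<le> cmod (c m))"
  shows "(\<Sum>j<J. (2 ^ j) powr (p - 1) * b j powr p) \<le> 2 * (\<Sum>k. lorentz_term q p c k)"
proof -
  define T where "T k = real k powr (p - 2) * rearr c k powr p" for k
  have T0: "T k \<ge> 0" for k by (simp add: T_def)
  have block: "(2 ^ j) powr (p - 1) * b j powr p \<le> 2 * (\<Sum>k\<in>{2^j..<2^Suc j}. T k)" for j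
  proof -
    define N where "N = (2::real) ^ j"
    have N: "N > 0" by (simp add: N_def)
    have "(2 * N) powr (p - 2) * b j powr p \<le> T k" if k: "k \<in> {2^j..<2^Suc j}" for k
    proof -
      obtain F where F: "finite F" "2 ^ Suc j \<le> card F" "\<forall>m\<in>F. b j \<le> cmod (c m)" using F by blast
      have "real k \<le> real (2 ^ Suc j)" using k by (intro of_nat_mono) auto
      then have k2: "0 < real k" "real k \<le> 2 * N" using k by (auto simp: N_def intro!: Nat.gr0I)
      have "1 \<le> (2::nat) ^ j" by simp
      then have "k \<ge> 1" using k by (meson atLeastLessThan_iff order_trans)
      then have "b j \<le> rearr c k" using F k by (intro rearr_ge[OF c]) auto
      then show ?thesis
        unfolding T_def using k2 b p by (intro mult_mono powr_mono2 powr_mono2') auto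
    qed
    then have "real (card {2^j..<(2::nat)^Suc j}) * ((2 * N) powr (p - 2) * b j powr p) \<le> (\<Sum>k\<in>{2^j..<2^Suc j}. T k)"
      by (intro sum_bounded_below) auto
    then have 1: "N * ((2 * N) powr (p - 2) * b j powr p) \<le> (\<Sum>k\<in>{2^j..<2^Suc j}. T k)"
      by (simp add: N_def)
    have "2 powr (-1) \<le> (2::real) powr (p - 2)" using p by (intro powr_mono) auto
    then have "1 \<le> 2 * 2 powr (p - 2)" by (simp add: powr_minus)
    then have "1 * (N powr (p - 1) * b j powr p) \<le> (2 * 2 powr (p - 2)) * (N powr (p - 1) * b j powr p)"
      by (intro mult_right_mono) auto
    also have "\<dots> = 2 * (N * ((2 * N) powr (p - 2) * b j powr p))"
    proof -
      have "N powr 1 * N powr (p - 2) = N powr (p - 1)" by (simp only: powr_add[symmetric]) simp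
      then have "N powr (p - 1) = N * N powr (p - 2)" using N by simp
      then show ?thesis using N by (simp add: powr_mult)
    qed
    finally show ?thesis using 1 unfolding N_def by linarith
  qed
  have "(\<Sum>j<J. (2 ^ j) powr (p - 1) * b j powr p) \<le> 2 * (\<Sum>k\<in>{1..<2^J}. T k)"
  proof (induction J)
    case (Suc J)
    have "(\<Sum>k\<in>{1..<2^Suc J}. T k) = (\<Sum>k\<in>{1..<2^J}. T k) + (\<Sum>k\<in>{2^J..<2^Suc J}. T k)"
      by (rule sum.atLeastLessThan_concat[symmetric]) simp_all
    then show ?case using Suc block[of J] by simp
  qed simp
  also have "(\<Sum>k\<in>{1..<2^J}. T k) = (\<Sum>k<2^J - 1. T (Suc k))"
  proof -
    obtain n where "(2::nat) ^ J = Suc n" using not0_implies_Suc[of "2 ^ J"] by auto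
    then show ?thesis using sum.shift_bounds_Suc_ivl[of T 0 n] by (simp add: atLeast0LessThan)
  qed
  also have "\<dots> = (\<Sum>k<2^J - 1. lorentz_term q p c k)"
    unfolding lorentz_term_conjugate[OF p(1) pq c] T_def ..
  also have "\<dots> \<le> (\<Sum>k. lorentz_term q p c k)"
    by (intro sum_le_suminf sum) (auto simp: lorentz_term_nonneg)
  finally show ?thesis by simp
qed

subsection \<open>Boundedness\<close>

lemma torus_rel_refl_iff: "torus_rel f f \<longleftrightarrow> f \<in> borel_measurable torus"
  by (auto simp: torus_rel_def)

text \<open>The quotient is partial, so the chosen representative is related to itself, which is
  exactly measurability.\<close>

lemma torus_fun_cases:
  obtains f :: "real ^ 'd::finite \<Rightarrow> complex"
  where "f \<in> borel_measurable torus" "\<xi> = abs_torus_fun f"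
  using Quotient_rep_reflp[OF Quotient_torus_fun, of \<xi>] Quotient_abs_rep[OF Quotient_torus_fun, of \<xi>]
  by (metis torus_rel_refl_iff)

lemma fourier_abs:
  assumes "f \<in> borel_measurable torus"
  shows "fourier (abs_torus_fun f) = fcoef f"
  using fourier.abs_eq[of f] assms unfolding torus_rel_refl_iff fcoef_def phase_def by auto

lemma powr_add_le:
  fixes a b p :: real
  assumes "a \<ge> 0" "b \<ge> 0" "p \<ge> 0"
  shows "(a + b) powr p \<le> 2 powr p * (a powr p + b powr p)"
proof -
  have "(a + b) powr p \<le> (2 * max a b) powr p" using assms by (intro powr_mono2) auto
  also have "\<dots> = 2 powr p * max a b powr p" using assms by (simp add: powr_mult)
  also have "\<dots> \<le> 2 powr p * (a powr p + b powr p)"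
    by (intro mult_left_mono) (auto simp: max_def)
  finally show ?thesis .
qed

lemma integrable_powr_add:
  fixes f g :: "'a \<Rightarrow> complex"
  assumes [measurable]: "f \<in> borel_measurable M" "g \<in> borel_measurable M" and "p \<ge> 0"
    and "integrable M (\<lambda>t. cmod (f t) powr p)" "integrable M (\<lambda>t. cmod (g t) powr p)"
  shows "integrable M (\<lambda>t. cmod (f t + g t) powr p)"
proof (rule Bochner_Integration.integrable_bound)
  show "integrable M (\<lambda>t. 2 powr p * (cmod (f t) powr p + cmod (g t) powr p))"
    using assms by simp
  show "AE t in M. norm (cmod (f t + g t) powr p) \<le> norm (2 powr p * (cmod (f t) powr p + cmod (g t) powr p))"
  proof (rule AE_I2)
    fix t
    have "cmod (f t + g t) powr p \<le> (cmod (f t) + cmod (g t)) powr p"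
      using \<open>p \<ge> 0\<close> by (intro powr_mono2 norm_triangle_ineq) auto
    also have "\<dots> \<le> 2 powr p * (cmod (f t) powr p + cmod (g t) powr p)"
      using \<open>p \<ge> 0\<close> by (intro powr_add_le) auto
    finally show "norm (cmod (f t + g t) powr p) \<le> norm (2 powr p * (cmod (f t) powr p + cmod (g t) powr p))"
      by simp
  qed
qed measurable

lemma integrable_powr_mult:
  fixes f :: "'a \<Rightarrow> complex"
  assumes "integrable M (\<lambda>t. cmod (f t) powr p)"
  shows "integrable M (\<lambda>t. cmod (a * f t) powr p)"
  using assms by (simp add: norm_mult powr_mult)

text \<open>Pointwise \<open>|f| <= |f| powr p + 1\<close>, and constants are integrable.\<close>

lemma (in finite_measure) integrable_of_powr:
  fixes f :: "'a \<Rightarrow> complex"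
  assumes [measurable]: "f \<in> borel_measurable M" and "p \<ge> 1" and fp: "integrable M (\<lambda>t. cmod (f t) powr p)"
  shows "integrable M f"
proof (rule Bochner_Integration.integrable_bound[OF Bochner_Integration.integrable_add[OF fp integrable_const[of 1]]])
  show "AE t in M. cmod (f t) \<le> norm (cmod (f t) powr p + 1)"
  proof (rule AE_I2)
    fix t
    have "cmod (f t) \<le> cmod (f t) powr p + 1"
    proof (cases "cmod (f t) \<le> 1")
      case False
      then have "cmod (f t) powr 1 \<le> cmod (f t) powr p" using \<open>p \<ge> 1\<close> by (intro powr_mono) auto
      then show ?thesis by simp
    qed (simp add: add_increasing)
    then show "cmod (f t) \<le> norm (cmod (f t) powr p + 1)" by simp
  qed
qed fact

lemmas integrable_torus_of_powr = finite_measure.integrable_of_powr[OF finite_measure_torus]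

lemma infinite_UNIV_int_vec: "infinite (UNIV :: (int ^ 'd::finite) set)"
proof
  assume "finite (UNIV :: (int ^ 'd) set)"
  then have "finite (range (\<lambda>n. axis (undefined :: 'd) n :: int ^ 'd))"
    by (rule finite_subset[rotated]) simp
  moreover have "inj (\<lambda>n. axis (undefined :: 'd) n :: int ^ 'd)"
    by (auto simp: inj_on_def axis_eq_axis)
  ultimately show False using finite_imageD infinite_UNIV_int by blast
qed

lemma fcoef_cmult: "fcoef (\<lambda>t. a * f t) m = a * fcoef f m"
  by (simp add: fcoef_def mult.assoc)

lemma bounded_fcoef:
  assumes "integrable torus f"
  shows "bounded (range (fcoef f))"
  using fcoef_bound[OF assms] by (auto simp: bounded_iff)

lemma fcoef_lorentz:
  fixes f :: "real ^ 'd::finite \<Rightarrow> complex" and p q :: real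
  assumes p: "1 < p" "p < 2" and pq: "1 / p + 1 / q = 1" and f: "f \<in> borel_measurable torus"
    and fp: "integrable torus (\<lambda>t. cmod (f t) powr p)"
  shows "summable (lorentz_term q p (fcoef f))"
    and "(\<Sum>k. lorentz_term q p (fcoef f) k) \<le>
      2 powr p * (p * (2 / (p - 1) + (2 * pi) ^ CARD('d) / (2 - p))) * (\<integral>t. cmod (f t) powr p \<partial>torus)"
proof -
  have i: "integrable torus f"
    using p fp f by (intro integrable_torus_of_powr) auto
  note l = lorentz_bound[OF infinite_UNIV_int_vec bounded_fcoef[OF i] p(1) pq paley_enumerated[OF p i fp]]
  show "summable (lorentz_term q p (fcoef f))" by (rule l(1))
  show "(\<Sum>k. lorentz_term q p (fcoef f) k) \<le>
      2 powr p * (p * (2 / (p - 1) + (2 * pi) ^ CARD('d) / (2 - p))) * (\<integral>t. cmod (f t) powr p \<partial>torus)"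
    by (rule l(2))
qed

lemma fourier_bounded:
  fixes p q :: real
  assumes p: "1 < p" "p < 2" and pq: "1 / p + 1 / q = 1"
  shows "bounded_linear_operator (Lp_space p) (lorentz_space q p)
    (fourier :: 'd::finite torus_fun \<Rightarrow> (int ^ 'd \<Rightarrow> complex))"
proof -
  let ?C = "2 powr p * (p * (2 / (p - 1) + (2 * pi) ^ CARD('d) / (2 - p)))"
  have carrier: "Lp_integrable p (abs_torus_fun f) \<longleftrightarrow> integrable torus (\<lambda>t. cmod (f t) powr p)"
    if "f \<in> borel_measurable torus" for f :: "real ^ 'd \<Rightarrow> complex"
    using that by (simp add: Lp_integrable.abs_eq torus_rel_refl_iff)
  have L1: "integrable torus f"
    if "f \<in> borel_measurable torus" "Lp_integrable p (abs_torus_fun f)" for f :: "real ^ 'd \<Rightarrow> complex"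
    using that carrier p by (intro integrable_torus_of_powr) auto
  have "fourier \<xi> \<in> vcarrier (lorentz_space q p)" if "Lp_integrable p \<xi>" for \<xi> :: "'d torus_fun"
  proof -
    obtain f where f: "f \<in> borel_measurable torus" "\<xi> = abs_torus_fun f" by (rule torus_fun_cases)
    have "Lp_integrable p (abs_torus_fun f)" using that f(2) by simp
    then have "bounded (range (fcoef f))" "summable (lorentz_term q p (fcoef f))"
      using bounded_fcoef[OF L1] fcoef_lorentz(1)[OF p pq] carrier f(1) by blast+
    then show ?thesis
      unfolding f(2) fourier_abs[OF f(1)] lorentz_space_def by simp
  qed
  moreover have "fourier (\<xi> + \<eta>) = fourier \<xi> + fourier \<eta>"
    if "Lp_integrable p \<xi>" "Lp_integrable p \<eta>" for \<xi> \<eta> :: "'d torus_fun"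
  proof -
    obtain f where f: "f \<in> borel_measurable torus" "\<xi> = abs_torus_fun f" by (rule torus_fun_cases)
    obtain g where g: "g \<in> borel_measurable torus" "\<eta> = abs_torus_fun g" by (rule torus_fun_cases)
    have "integrable torus f" "integrable torus g" using that f g L1 by blast+
    then have "fcoef (\<lambda>t. f t + g t) = fcoef f + fcoef g"
      by (intro ext) (simp add: fcoef_add)
    moreover have "(\<lambda>t. f t + g t) \<in> borel_measurable torus"
      using f(1) g(1) by (rule borel_measurable_add)
    ultimately show ?thesis
      using f g by (simp add: plus_torus_fun.abs_eq torus_rel_refl_iff fourier_abs)
  qed
  moreover have "fourier (scale_torus_fun a \<xi>) = (\<lambda>m. a * fourier \<xi> m)" for a and \<xi> :: "'d torus_fun"
  proof -
    obtain f where f: "f \<in> borel_measurable torus" "\<xi> = abs_torus_fun f" by (rule torus_fun_cases)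
    have "(\<lambda>t. a * f t) \<in> borel_measurable torus"
      using f(1) by measurable
    then show ?thesis
      using f by (simp add: scale_torus_fun.abs_eq torus_rel_refl_iff fourier_abs fcoef_cmult fun_eq_iff)
  qed
  \<comment> \<open>The operator bound is the \<open>p\<close>-th root of the constant in Paley's
    inequality.\<close>
  moreover have "vnorm (lorentz_space q p) (fourier \<xi>) \<le> ?C powr (1 / p) * Lp_norm p \<xi>"
    if "Lp_integrable p \<xi>" for \<xi> :: "'d torus_fun"
  proof -
    obtain f where f: "f \<in> borel_measurable torus" "\<xi> = abs_torus_fun f" by (rule torus_fun_cases)
    have fp: "integrable torus (\<lambda>t. cmod (f t) powr p)" using that f carrier by blast
    note l = fcoef_lorentz[OF p pq f(1) fp]
    have "(\<Sum>k. lorentz_term q p (fcoef f) k) powr (1 / p) \<le> (?C * (\<integral>t. cmod (f t) powr p \<partial>torus)) powr (1 / p)"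
      by (intro powr_mono2 l(2) suminf_nonneg[OF l(1)] lorentz_term_nonneg) (use p in simp)
    also have "\<dots> = ?C powr (1 / p) * (\<integral>t. cmod (f t) powr p \<partial>torus) powr (1 / p)"
      by (rule powr_mult)
    finally show ?thesis
      using f by (simp add: lorentz_space_def fourier_abs Lp_norm.abs_eq torus_rel_refl_iff)
  qed
  ultimately show ?thesis
    unfolding bounded_linear_operator_def Lp_space_def lorentz_space_def normed_sp.simps mem_Collect_eq
    by blast
qed

subsection \<open>Spaces of step functions\<close>

text \<open>Closedness holds for all measurable \<open>J\<close> and \<open>w\<close>. Later
  \<open>J\<close> is the dyadic level of one coordinate and \<open>w\<close> the modulated wave,
  which makes the space a weighted copy of \<open>l^p\<close>.\<close>

definition step_space ::
    "real \<Rightarrow> (real ^ 'd::finite \<Rightarrow> nat) \<Rightarrow> (real ^ 'd \<Rightarrow> complex) \<Rightarrow> 'd torus_fun set" where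
  "step_space p J w = {abs_torus_fun (\<lambda>t. \<alpha> (J t) * w t) | \<alpha>. integrable torus (\<lambda>t. cmod (\<alpha> (J t) * w t) powr p)}"

lemma step_measurable:
  assumes "J \<in> measurable M (count_space UNIV)" "w \<in> borel_measurable M"
  shows "(\<lambda>t. \<alpha> (J t) * w t :: complex) \<in> borel_measurable M"
  using assms by (intro borel_measurable_times measurable_compose[OF assms(1)]) auto

text \<open>For closedness, convergence in \<open>L^p\<close> gives convergence almost everywhere
  along a subsequence. Where \<open>w\<close> does not vanish one can divide by it, so the
  coefficients on that fibre converge and the limit is again a step function times
  \<open>w\<close>.\<close>

lemma closed_subspace_step_space:
  fixes J :: "real ^ 'd::finite \<Rightarrow> nat"
  assumes J: "J \<in> measurable torus (count_space UNIV)" and w: "w \<in> borel_measurable torus" and p: "p \<ge> 1"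
  shows "closed_subspace (Lp_space p) (step_space p J w)"
proof -
  interpret vector_space "scale_torus_fun :: complex \<Rightarrow> 'd torus_fun \<Rightarrow> 'd torus_fun"
    by (rule vector_space_torus_fun)
  let ?s = "\<lambda>\<alpha>::nat \<Rightarrow> complex. \<lambda>t. \<alpha> (J t) * w t"
  note m = step_measurable[OF J w]
  have r: "torus_rel (?s \<alpha>) (?s \<alpha>)" for \<alpha>
    by (simp add: torus_rel_refl_iff m)
  have 1: "step_space p J w \<subseteq> vcarrier (Lp_space p)"
    by (auto simp: step_space_def Lp_space_def Lp_integrable.abs_eq r)
  have "0 \<in> step_space p J w"
    unfolding step_space_def by (intro CollectI exI[of _ "\<lambda>_. 0"]) (simp add: zero_torus_fun.abs_eq)
  moreover have "x + y \<in> step_space p J w" if x: "x \<in> step_space p J w" and y: "y \<in> step_space p J w" for x y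
  proof -
    obtain \<alpha> where a: "x = abs_torus_fun (?s \<alpha>)" "integrable torus (\<lambda>t. cmod (?s \<alpha> t) powr p)"
      using x by (auto simp: step_space_def)
    obtain \<beta> where b: "y = abs_torus_fun (?s \<beta>)" "integrable torus (\<lambda>t. cmod (?s \<beta> t) powr p)"
      using y by (auto simp: step_space_def)
    have "integrable torus (\<lambda>t. cmod (?s \<alpha> t + ?s \<beta> t) powr p)"
      using a b p m by (intro integrable_powr_add) auto
    then show ?thesis
      unfolding step_space_def using a(1) b(1)
      by (intro CollectI exI[of _ "\<lambda>j. \<alpha> j + \<beta> j"]) (simp add: plus_torus_fun.abs_eq r distrib_right)
  qed
  moreover have "scale_torus_fun c x \<in> step_space p J w" if x: "x \<in> step_space p J w" for c x
  proof -
    obtain \<alpha> where a: "x = abs_torus_fun (?s \<alpha>)" "integrable torus (\<lambda>t. cmod (?s \<alpha> t) powr p)"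
      using x by (auto simp: step_space_def)
    from integrable_powr_mult[OF a(2), of c] show ?thesis
      unfolding step_space_def using a(1)
      by (intro CollectI exI[of _ "\<lambda>j. c * \<alpha> j"]) (simp add: scale_torus_fun.abs_eq r mult.assoc)
  qed
  ultimately have 2: "subspace (step_space p J w)"
    by (simp add: subspace_def)
  have "x \<in> step_space p J w"
    if sE: "\<And>n::nat. s n \<in> step_space p J w" and x: "Lp_integrable p x"
      and lim: "(\<lambda>n. Lp_norm p (s n - x)) \<longlonglongrightarrow> 0" for s x
  proof -
    obtain g where g: "g \<in> borel_measurable torus" "x = abs_torus_fun g" by (rule torus_fun_cases)
    have gp: "integrable torus (\<lambda>t. cmod (g t) powr p)"
      using x g by (simp add: Lp_integrable.abs_eq torus_rel_refl_iff)
    have "\<exists>\<alpha>. s n = abs_torus_fun (?s \<alpha>) \<and> integrable torus (\<lambda>t. cmod (?s \<alpha> t) powr p)" for n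
      using sE[of n] by (auto simp: step_space_def)
    then obtain a where a: "\<And>n. s n = abs_torus_fun (?s (a n))"
      "\<And>n. integrable torus (\<lambda>t. cmod (?s (a n) t) powr p)"
      using choice[of "\<lambda>n \<alpha>. s n = abs_torus_fun (?s \<alpha>) \<and> integrable torus (\<lambda>t. cmod (?s \<alpha> t) powr p)"]
      by blast
    define h where "h n t = cmod (?s (a n) t - g t) powr p" for n t
    have mh: "(\<lambda>t. ?s (a n) t - g t) \<in> borel_measurable torus" for n
      using m g(1) by (rule borel_measurable_diff)
    have ih: "integrable torus (h n)" for n
    proof -
      have "integrable torus (\<lambda>t. cmod (?s (a n) t + (- 1) * g t) powr p)"
        using g(1) p by (intro integrable_powr_add a(2) integrable_powr_mult gp m) auto
      then show ?thesis unfolding h_def by simp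
    qed
    have nx: "Lp_norm p (s n - x) = (\<integral>t. h n t \<partial>torus) powr (1 / p)" for n
      unfolding a(1) g(2) h_def minus_torus_fun.abs_eq[OF r g(1)[folded torus_rel_refl_iff]]
        Lp_norm.abs_eq[OF mh[folded torus_rel_refl_iff]] ..
    have "(\<lambda>n. ((\<integral>t. h n t \<partial>torus) powr (1 / p)) powr p) \<longlonglongrightarrow> 0 powr p"
      by (rule tendsto_powr'[OF lim[unfolded nx] tendsto_const]) (use p in simp)
    moreover have "((\<integral>t. h n t \<partial>torus) powr (1 / p)) powr p = (\<integral>t. norm (h n t) \<partial>torus)" for n
    proof -
      have "(\<integral>t. h n t \<partial>torus) \<ge> 0" by (simp add: h_def)
      then show ?thesis using p by (simp add: powr_powr h_def)
    qed
    ultimately have "(\<lambda>n. \<integral>t. norm (h n t) \<partial>torus) \<longlonglongrightarrow> 0" using p by simp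
    from tendsto_L1_AE_subseq[OF ih this] obtain k where "AE t in torus. (\<lambda>n. h (k n) t) \<longlonglongrightarrow> 0"
      by blast
    then have conv: "AE t in torus. (\<lambda>n. ?s (a (k n)) t) \<longlonglongrightarrow> g t"
    proof eventually_elim
      case (elim t)
      have "(\<lambda>n. (h (k n) t) powr (1 / p)) \<longlonglongrightarrow> 0 powr (1 / p)"
        by (rule tendsto_powr'[OF elim tendsto_const]) (use p in \<open>simp add: h_def\<close>)
      moreover have "(h (k n) t) powr (1 / p) = cmod (?s (a (k n)) t - g t)" for n
        using p by (simp add: powr_powr h_def)
      ultimately have "(\<lambda>n. cmod (?s (a (k n)) t - g t)) \<longlonglongrightarrow> 0" by simp
      then have "(\<lambda>n. ?s (a (k n)) t - g t) \<longlonglongrightarrow> 0" by (rule tendsto_norm_zero_cancel)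
      then show ?case by (rule LIM_zero_cancel)
    qed
    \<comment> \<open>\<open>lim\<close> is arbitrary where the coefficients diverge, but almost
      every \<open>t\<close> with \<open>w t \<noteq> 0\<close> has convergent coefficients at
      \<open>J t\<close>.\<close>
    define b where "b j = lim (\<lambda>n. a (k n) j)" for j
    have "AE t in torus. g t = ?s b t"
      using conv
    proof eventually_elim
      case (elim t)
      show ?case
      proof (cases "w t = 0")
        case True
        then show ?thesis using elim LIMSEQ_unique[OF elim, of 0] by simp
      next
        case False
        have "(\<lambda>n. ?s (a (k n)) t / w t) \<longlonglongrightarrow> g t / w t"
          using elim False by (intro tendsto_divide) auto
        then have "(\<lambda>n. a (k n) (J t)) \<longlonglongrightarrow> g t / w t" using False by simp
        then have "b (J t) = g t / w t" unfolding b_def by (rule limI)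
        then show ?thesis using False by simp
      qed
    qed
    then have "torus_rel g (?s b)" using g(1) m by (simp add: torus_rel_def)
    then have "x = abs_torus_fun (?s b)"
      unfolding g(2) by (rule Quotient_rel_abs[OF Quotient_torus_fun])
    moreover from this x have "integrable torus (\<lambda>t. cmod (?s b t) powr p)"
      by (simp add: Lp_integrable.abs_eq r)
    ultimately show ?thesis by (auto simp: step_space_def)
  qed
  then have 3: "\<forall>s x. (\<forall>n::nat. s n \<in> step_space p J w) \<and> x \<in> vcarrier (Lp_space p) \<and>
      (\<lambda>n. vnorm (Lp_space p) (s n - x)) \<longlonglongrightarrow> 0 \<longrightarrow> x \<in> step_space p J w"
    by (auto simp: Lp_space_def)
  from 1 2 3 show ?thesis by (simp add: closed_subspace_def Lp_space_def)
qed

text \<open>The restrictions \<open>\<phi> j\<close> of \<open>w\<close> to single fibres are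
  independent: the subspace \<open>W j\<close> of functions vanishing almost everywhere on fibre
  \<open>j\<close> contains every other \<open>\<phi> i\<close> but not \<open>\<phi> j\<close>. A
  finite spanning set would bound their number.\<close>

lemma infinite_dimensional_step_space:
  fixes J :: "real ^ 'd::finite \<Rightarrow> nat"
  assumes J: "J \<in> measurable torus (count_space UNIV)" and w: "w \<in> borel_measurable torus" and p: "p \<ge> 1"
    and wb: "\<And>t. cmod (w t) \<le> 1" and nz: "\<And>j. \<not> (AE t in torus. J t = j \<longrightarrow> w t = 0)"
  shows "infinite_dimensional (Lp_space p) (step_space p J w)"
proof -
  interpret vector_space "scale_torus_fun :: complex \<Rightarrow> 'd torus_fun \<Rightarrow> 'd torus_fun"
    by (rule vector_space_torus_fun)
  interpret finite_measure "torus :: (real^'d) measure" by (rule finite_measure_torus)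
  note m = step_measurable[OF J w]
  define \<phi> where "\<phi> j = abs_torus_fun (\<lambda>t. (if J t = j then 1 else 0) * w t)" for j
  have \<phi>E: "\<phi> j \<in> step_space p J w" for j
  proof -
    have "integrable torus (\<lambda>t. cmod ((if J t = j then 1 else 0) * w t) powr p)"
    proof (rule integrable_const_bound[of _ 1])
      show "(\<lambda>t. cmod ((if J t = j then 1 else 0) * w t) powr p) \<in> borel_measurable torus"
        using m[of "\<lambda>i. if i = j then 1 else 0"] by measurable
      show "AE t in torus. norm (cmod ((if J t = j then 1 else 0) * w t) powr p) \<le> 1"
        using wb p by (auto intro!: powr_le1)
    qed
    then show ?thesis
      unfolding step_space_def \<phi>_def
      by (intro CollectI exI[of _ "\<lambda>i. if i = j then 1 else 0"]) simp
  qed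
  define W where "W j = {abs_torus_fun f | f. f \<in> borel_measurable torus \<and> (AE t in torus. J t = j \<longrightarrow> f t = 0)}" for j
  have subspaceW: "subspace (W j)" for j
  proof (rule subspaceI)
    show "0 \<in> W j"
      unfolding W_def zero_torus_fun.abs_eq by (intro CollectI exI[of _ "\<lambda>_. 0"]) simp
  next
    fix x y assume "x \<in> W j" "y \<in> W j"
    then obtain f g where f: "x = abs_torus_fun f" "f \<in> borel_measurable torus" "AE t in torus. J t = j \<longrightarrow> f t = 0"
      and g: "y = abs_torus_fun g" "g \<in> borel_measurable torus" "AE t in torus. J t = j \<longrightarrow> g t = 0"
      unfolding W_def by blast
    have "AE t in torus. J t = j \<longrightarrow> f t + g t = 0"
      using f(3) g(3) by eventually_elim auto
    moreover have "(\<lambda>t. f t + g t) \<in> borel_measurable torus" using f(2) g(2) by (rule borel_measurable_add)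
    ultimately show "x + y \<in> W j"
      unfolding W_def using f(1,2) g(1,2)
      by (intro CollectI exI[of _ "\<lambda>t. f t + g t"]) (simp add: plus_torus_fun.abs_eq torus_rel_refl_iff)
  next
    fix c x assume "x \<in> W j"
    then obtain f where f: "x = abs_torus_fun f" "f \<in> borel_measurable torus" "AE t in torus. J t = j \<longrightarrow> f t = 0"
      unfolding W_def by blast
    have "AE t in torus. J t = j \<longrightarrow> c * f t = 0"
      using f(3) by eventually_elim auto
    moreover have "(\<lambda>t. c * f t) \<in> borel_measurable torus" using f(2) by measurable
    ultimately show "scale_torus_fun c x \<in> W j"
      unfolding W_def using f(1,2)
      by (intro CollectI exI[of _ "\<lambda>t. c * f t"]) (simp add: scale_torus_fun.abs_eq torus_rel_refl_iff)
  qed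
  have \<phi>W: "\<phi> i \<in> W j" if "i \<noteq> j" for i j
    unfolding W_def \<phi>_def using m[of "\<lambda>k. if k = i then 1 else 0"] that
    by (intro CollectI exI[of _ "\<lambda>t. (if J t = i then 1 else 0) * w t"]) auto
  have \<phi>nW: "\<phi> j \<notin> W j" for j
  proof
    assume "\<phi> j \<in> W j"
    then obtain f where f: "\<phi> j = abs_torus_fun f" "f \<in> borel_measurable torus" "AE t in torus. J t = j \<longrightarrow> f t = 0"
      unfolding W_def by blast
    then have "torus_rel (\<lambda>t. (if J t = j then 1 else 0) * w t) f"
      using m[of "\<lambda>k. if k = j then 1 else 0"]
      unfolding \<phi>_def by (subst Quotient_rel[OF Quotient_torus_fun, symmetric]) (simp add: torus_rel_refl_iff)
    then have "AE t in torus. (if J t = j then 1 else 0) * w t = f t"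
      by (simp add: torus_rel_def)
    with f(3) have "AE t in torus. J t = j \<longrightarrow> w t = 0"
      by eventually_elim auto
    with nz show False by blast
  qed
  have inj: "inj \<phi>"
  proof (rule injI, rule ccontr)
    fix i j assume "\<phi> i = \<phi> j" "i \<noteq> j"
    then show False using \<phi>W[of i j] \<phi>nW[of j] by simp
  qed
  have "independent (range \<phi>)"
    unfolding dependent_def
  proof clarify
    fix j assume "\<phi> j \<in> span (range \<phi> - {\<phi> j})"
    moreover have "span (range \<phi> - {\<phi> j}) \<subseteq> W j"
    proof (rule span_minimal[OF _ subspaceW], rule subsetI)
      fix x assume "x \<in> range \<phi> - {\<phi> j}"
      then obtain i where "x = \<phi> i" "i \<noteq> j" by blast
      then show "x \<in> W j" using \<phi>W by simp
    qed
    ultimately show False using \<phi>nW by blast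
  qed
  moreover have "infinite (range \<phi>)"
    using inj by (simp add: finite_image_iff)
  ultimately have "\<not> (finite B \<and> B \<subseteq> step_space p J w \<and> span B = step_space p J w)" for B
    using independent_span_bound[of B "range \<phi>"] \<phi>E by blast
  then show ?thesis by (simp add: infinite_dimensional_def Lp_space_def)
qed

text \<open>Dominated convergence for the truncations to \<open>J t < n\<close>, with dominating
  function \<open>norm (h t)\<close>.\<close>

lemma integral_sums_fibres:
  fixes h :: "'a \<Rightarrow> 'b::{banach, second_countable_topology}" and J :: "'a \<Rightarrow> nat"
  assumes [measurable]: "J \<in> measurable M (count_space UNIV)" and h: "integrable M h"
  shows "(\<lambda>j. \<integral>t. (if J t = j then h t else 0) \<partial>M) sums (\<integral>t. h t \<partial>M)"
proof -
  have [measurable]: "h \<in> borel_measurable M" using h by simp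
  have i: "integrable M (\<lambda>t. if J t = j then h t else 0)" for j
    by (rule Bochner_Integration.integrable_bound[OF h]) auto
  have "(\<lambda>n. \<integral>t. (if J t < n then h t else 0) \<partial>M) \<longlonglongrightarrow> (\<integral>t. h t \<partial>M)"
  proof (rule integral_dominated_convergence[where w = "\<lambda>t. norm (h t)"])
    show "AE t in M. (\<lambda>n. if J t < n then h t else 0) \<longlonglongrightarrow> h t"
      by (intro AE_I2 tendsto_eventually) (auto simp: eventually_at_top_dense)
  qed (use h in auto)
  moreover have "(\<integral>t. (if J t < n then h t else 0) \<partial>M) = (\<Sum>j<n. \<integral>t. (if J t = j then h t else 0) \<partial>M)" for n
    by (subst Bochner_Integration.integral_sum[OF i, symmetric]) (simp add: sum.delta)
  ultimately show ?thesis by (simp add: sums_def)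
qed

subsection \<open>Lower bound on modulated dyadic steps\<close>

text \<open>The intervals \<open>{len j<..2 * len j}\<close> tile \<open>{0<..1 / 2}\<close>, which
  lies inside the period interval.\<close>

definition len :: "nat \<Rightarrow> real" where
  "len j = (1 / 2) ^ (j + 2)"

lemma len_pos [simp]: "0 < len j"
  by (simp add: len_def)

lemma len_nonneg [simp]: "0 \<le> len j"
  by (rule less_imp_le) simp

lemma len_Suc: "2 * len (Suc j) = len j"
  by (simp add: len_def)

lemma len_mult_power: "2 ^ j * len j = 1 / 4"
  by (simp add: len_def power_add power_one_over)

lemma len_antimono: "i \<le> j \<Longrightarrow> len j \<le> len i"
  unfolding len_def by (rule power_decreasing) auto

lemma two_len_le: "2 * len j \<le> 1 / 2"
  using len_antimono[of 0 j] by (simp add: len_def)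

text \<open>Gives the index of the dyadic interval containing \<open>x\<close> only for
  \<open>0 < x <= 1 / 2\<close>; elsewhere its value is immaterial because \<open>wave\<close>
  vanishes there.\<close>

definition level :: "real \<Rightarrow> nat" where
  "level x = (LEAST j. len j < x)"

lemma level_eq_iff:
  assumes "0 < x" "x \<le> 1 / 2"
  shows "level x = j \<longleftrightarrow> x \<in> {len j<..2 * len j}"
proof
  obtain n where "(1 / 2) ^ n < x" using real_arch_pow_inv[of x "1 / 2"] assms by auto
  moreover have "len n \<le> (1 / 2) ^ n" unfolding len_def by (rule power_decreasing) auto
  ultimately have ex: "len n < x" by linarith
  assume j: "level x = j"
  have "len j < x" using LeastI[of "\<lambda>j. len j < x", OF ex] j by (simp add: level_def)
  moreover have "x \<le> 2 * len j"
  proof (cases j)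
    case 0
    then show ?thesis using assms by (simp add: len_def)
  next
    case (Suc i)
    then have "\<not> len i < x" using not_less_Least[of i "\<lambda>j. len j < x"] j by (simp add: level_def)
    then show ?thesis using len_Suc[of i] Suc by simp
  qed
  ultimately show "x \<in> {len j<..2 * len j}" by simp
next
  assume x: "x \<in> {len j<..2 * len j}"
  show "level x = j"
    unfolding level_def
  proof (rule Least_equality)
    show "len j < x" using x by simp
    fix y assume y: "len y < x"
    show "j \<le> y"
    proof (rule ccontr)
      assume "\<not> j \<le> y"
      then have "len j \<le> len (Suc y)" by (intro len_antimono) simp
      then show False using x y len_Suc[of y] by simp
    qed
  qed
qed

text \<open>
  The constant \<open>65536\<close> makes the interference between different pieces at most a small fraction
  of the main term in \<open>step_lorentz_lower\<close>.
\<close>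

definition freq :: "nat \<Rightarrow> int" where
  "freq j = 65536 * 16 ^ j"

definition wave :: "real \<Rightarrow> complex" where
  "wave x = (if 0 < x \<and> x \<le> 1 / 2 then exp (\<i> * of_real (real_of_int (freq (level x)) * x)) else 0)"

lemma wave_level:
  "(if level x = j then \<alpha> (level x) * wave x else 0) =
    \<alpha> j * (indicator {len j<..2 * len j} x *\<^sub>R exp (\<i> * of_real (real_of_int (freq j) * x)))"
proof (cases "0 < x \<and> x \<le> 1 / 2")
  case True
  then show ?thesis using level_eq_iff[of x j] by (auto simp: wave_def indicator_def)
next
  case False
  then have "x \<notin> {len j<..2 * len j}" using len_pos[of j] two_len_le[of j] by auto
  moreover have "wave x = 0" using False by (auto simp: wave_def)
  ultimately show ?thesis by simp
qed

lemma norm_wave_le: "cmod (wave x) \<le> 1"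
  by (simp add: wave_def norm_exp_eq_Re)

lemma level_measurable [measurable]: "level \<in> measurable borel (count_space UNIV)"
  unfolding level_def by measurable

lemma wave_measurable [measurable]: "wave \<in> borel_measurable borel"
proof -
  have [measurable]: "(\<lambda>x. real_of_int (freq (level x))) \<in> borel_measurable borel"
    by (rule measurable_compose[OF level_measurable]) simp
  have [measurable]: "(\<lambda>z::complex. exp z) \<in> borel_measurable borel"
    by (intro borel_measurable_continuous_onI continuous_intros)
  show ?thesis unfolding wave_def by measurable
qed

section \<open>Fourier integrals of single slabs\<close>

lemma torus_component_measurable: "(\<lambda>t::real^'d::finite. t $ i) \<in> borel_measurable torus"
  by (intro continuous_imp_measurable_on_sets_lebesgue continuous_intros) auto

text \<open>The one-dimensional transform of the \<open>j\<close>-th interval at frequency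
  \<open>- k\<close>. Including the left endpoint does not affect the value and fits the fundamental
  theorem of calculus.\<close>

definition osc :: "nat \<Rightarrow> real \<Rightarrow> complex" where
  "osc j k = (LINT x:{len j..2 * len j}|lborel. exp (\<i> * of_real (k * x)))"

lemma norm_osc_le:
  assumes "k \<noteq> 0"
  shows "cmod (osc j k) \<le> 2 / \<bar>k\<bar>"
proof -
  have "cmod (osc j k) = cmod (exp (\<i> * of_real (k * (2 * len j))) - exp (\<i> * of_real (k * len j))) / \<bar>k\<bar>"
    unfolding osc_def using less_imp_le[OF len_pos[of j]] assms
    by (subst integral_exp_Icc) (auto simp: norm_divide norm_mult)
  also have "cmod (exp (\<i> * of_real (k * (2 * len j))) - exp (\<i> * of_real (k * len j))) \<le> 1 + 1"
    by (rule order_trans[OF norm_triangle_ineq4]) (simp add: norm_exp_eq_Re)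
  finally show ?thesis by (simp add: divide_right_mono)
qed

text \<open>No cancellation at low frequency: after rotation by \<open>z\<close>, which removes the
  phase at the left endpoint, the argument stays within \<open>1 / 2 < pi / 3\<close>, so the real
  part of the integrand is at least \<open>cos (pi / 3)\<close>.\<close>

lemma norm_osc_ge:
  assumes "\<bar>k\<bar> * len j \<le> 1 / 2"
  shows "len j / 2 \<le> cmod (osc j k)"
proof -
  let ?A = "{len j..2 * len j}"
  define z where "z = exp (- (\<i> * of_real (k * len j)))"
  have z: "cmod z = 1" by (simp add: z_def norm_exp_eq_Re)
  have i: "integrable lborel (\<lambda>x. indicator ?A x *\<^sub>R exp (\<i> * of_real (k * x)))"
    using set_integrable_exp[of "len j" "2 * len j" k] by (simp add: set_integrable_def)
  have "len j / 2 = (\<integral>x. indicator ?A x *\<^sub>R (1 / 2) \<partial>lborel)"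
    using less_imp_le[OF len_pos[of j]] by simp
  also have "\<dots> \<le> (\<integral>x. Re (z * (indicator ?A x *\<^sub>R exp (\<i> * of_real (k * x)))) \<partial>lborel)"
  proof (rule integral_mono)
    show "integrable lborel (\<lambda>x. Re (z * (indicator ?A x *\<^sub>R exp (\<i> * of_real (k * x)))))"
      by (intro integrable_Re integrable_mult_right i)
    fix x
    show "indicator ?A x *\<^sub>R (1 / 2) \<le> Re (z * (indicator ?A x *\<^sub>R exp (\<i> * of_real (k * x))))"
    proof (cases "x \<in> ?A")
      case True
      have "\<bar>k * (x - len j)\<bar> \<le> \<bar>k\<bar> * len j"
        unfolding abs_mult using True by (intro mult_left_mono) auto
      also have "\<dots> \<le> pi / 3" using assms pi_gt3 by simp
      finally have "cos (pi / 3) \<le> cos \<bar>k * (x - len j)\<bar>"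
        by (intro cos_monotone_0_pi_le) auto
      then have "1 / 2 \<le> cos (k * (x - len j))" by (simp add: cos_60)
      also have "\<dots> = Re (z * exp (\<i> * of_real (k * x)))"
        unfolding z_def exp_add[symmetric] by (simp add: Re_exp algebra_simps)
      finally show ?thesis using True by simp
    qed simp
  qed simp
  also have "\<dots> = Re (z * osc j k)"
    unfolding osc_def set_lebesgue_integral_def
    by (subst integral_Re[OF integrable_mult_right[OF i]]) (simp only: integral_mult_right_zero)
  also have "\<dots> \<le> cmod (z * osc j k)" by (rule complex_Re_le_cmod)
  finally show ?thesis by (simp add: norm_mult z)
qed

text \<open>Each of the coordinates other than \<open>i\<close> contributes a factor
  \<open>2 * pi\<close>.\<close>

lemma torus_integral_slab:
  fixes F :: "real \<Rightarrow> complex" and i :: "'d::finite"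
  assumes "set_integrable lborel {-pi..pi} F"
  shows "(\<integral>t. F (t $ i) \<partial>(torus :: (real^'d) measure)) = of_real ((2 * pi) ^ (CARD('d) - 1)) * (LINT x:{-pi..pi}|lborel. F x)"
proof -
  let ?g = "\<lambda>k x. if k = i then F x else 1"
  have 1: "(LINT x:{-pi..pi}|lborel. (1::complex)) = of_real (2 * pi)"
    by (simp add: set_lebesgue_integral_def scaleR_conv_of_real)
  have "set_integrable lborel {-pi..pi} (\<lambda>x. 1 :: complex)"
    using set_integrable_exp[of "-pi" pi 0] by simp
  then have g: "set_integrable lborel {-pi..pi} (?g k)" for k
    using assms by (cases "k = i") simp_all
  have "(\<integral>t. F (t $ i) \<partial>(torus :: (real^'d) measure)) = (\<integral>t. (\<Prod>k\<in>UNIV. ?g k (t $ k)) \<partial>torus)"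
    by (simp add: prod.delta)
  also have "\<dots> = (\<Prod>k\<in>UNIV. LINT x:{-pi..pi}|lborel. ?g k x)"
    by (rule torus_integral_prod[OF g])
  also have "\<dots> = (LINT x:{-pi..pi}|lborel. F x) * (\<Prod>k\<in>UNIV - {i}. LINT x:{-pi..pi}|lborel. ?g k x)"
    by (subst prod.remove[of _ i]) auto
  also have "(\<Prod>k\<in>UNIV - {i}. LINT x:{-pi..pi}|lborel. ?g k x) = (\<Prod>k\<in>UNIV - {i}. of_real (2 * pi))"
    by (intro prod.cong refl) (simp only: Diff_iff insert_iff if_False 1, simp add: 1)
  finally show ?thesis by (simp add: card_Diff_singleton mult.commute)
qed

lemma torus_integral_slab_interval:
  fixes i :: "'d::finite"
  shows "(\<integral>t. indicator {len j<..2 * len j} (t $ i) *\<^sub>R exp (\<i> * of_real (k * (t $ i))) \<partial>(torus :: (real^'d) measure)) =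
    of_real ((2 * pi) ^ (CARD('d) - 1)) * osc j k"
proof -
  let ?F = "\<lambda>x. indicator {len j<..2 * len j} x *\<^sub>R exp (\<i> * of_real (k * x))"
  have "2 * len j \<le> pi" using two_len_le[of j] pi_gt3 by linarith
  then have "- pi \<le> x \<and> x \<le> pi" if "x \<in> {len j<..2 * len j}" for x
    using len_pos[of j] pi_gt_zero that[unfolded greaterThanAtMost_iff] by linarith
  then have sub: "{len j<..2 * len j} \<subseteq> {-pi..pi}" by auto
  have e: "indicator {-pi..pi} x *\<^sub>R ?F x = ?F x" for x
    using sub by (auto simp: indicator_def)
  have "set_integrable lborel {len j<..2 * len j} (\<lambda>x. exp (\<i> * of_real (k * x)))"
    by (rule set_integrable_subset[OF set_integrable_exp[of "len j" "2 * len j" k]]) auto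
  then have int: "set_integrable lborel {-pi..pi} ?F"
    unfolding set_integrable_def e .
  have "(LINT x:{-pi..pi}|lborel. ?F x) = (LINT x:{len j<..2 * len j}|lborel. exp (\<i> * of_real (k * x)))"
    unfolding set_lebesgue_integral_def e ..
  also have "\<dots> = osc j k"
    unfolding osc_def using interval_integral_Icc[of "len j" "2 * len j" "\<lambda>x. exp (\<i> * of_real (k * x))"]
      interval_integral_Ioc[of "len j" "2 * len j" "\<lambda>x. exp (\<i> * of_real (k * x))"] len_pos[of j] by simp
  finally show ?thesis
    by (simp only: torus_integral_slab[OF int])
qed

lemma osc_0: "osc j 0 = of_real (len j)"
  using len_pos[of j] by (simp add: osc_def set_lebesgue_integral_def scaleR_conv_of_real less_imp_le)

lemma phase_axis: "phase (axis i n) t = exp (\<i> * of_real (- real_of_int n * (t $ i)))"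
proof -
  have "(\<Sum>k\<in>UNIV. t $ k * real_of_int (axis i n $ k)) = (\<Sum>k\<in>UNIV. if k = i then t $ k * real_of_int n else 0)"
    by (intro sum.cong refl) (simp add: axis_def)
  then show ?thesis by (simp add: phase_def algebra_simps)
qed

text \<open>Splitting by level, the modulation of piece \<open>j\<close> shifts its frequency, so
  piece \<open>j\<close> contributes \<open>osc\<close> at \<open>freq j - n\<close>. Frequencies on
  the \<open>i\<close>-th axis suffice for the lower bound.\<close>

lemma fcoef_step_sums:
  fixes i :: "'d::finite" and \<alpha> :: "nat \<Rightarrow> complex"
  assumes "integrable (torus :: (real^'d) measure) (\<lambda>t. \<alpha> (level (t $ i)) * wave (t $ i))"
  shows "(\<lambda>j. of_real ((2 * pi) ^ (CARD('d) - 1)) * (\<alpha> j * osc j (real_of_int (freq j - n)))) sums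
    fcoef (\<lambda>t::real^'d. \<alpha> (level (t $ i)) * wave (t $ i)) (axis i n)"
proof -
  let ?f = "\<lambda>t::real^'d. \<alpha> (level (t $ i)) * wave (t $ i)"
  have J: "(\<lambda>t::real^'d. level (t $ i)) \<in> measurable torus (count_space UNIV)"
    by (rule measurable_compose[OF torus_component_measurable level_measurable])
  have "(\<integral>t. (if level (t $ i) = j then ?f t * phase (axis i n) t else 0) \<partial>torus) =
      of_real ((2 * pi) ^ (CARD('d) - 1)) * (\<alpha> j * osc j (real_of_int (freq j - n)))" for j
  proof -
    have "(if level (t $ i) = j then ?f t * phase (axis i n) t else 0) =
       \<alpha> j * (indicator {len j<..2 * len j} (t $ i) *\<^sub>R exp (\<i> * of_real (real_of_int (freq j - n) * (t $ i))))" for t :: "real^'d"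
    proof -
      have "(if level (t $ i) = j then ?f t * phase (axis i n) t else 0) =
          (if level (t $ i) = j then ?f t else 0) * phase (axis i n) t" by simp
      also have "\<dots> = \<alpha> j * (indicator {len j<..2 * len j} (t $ i) *\<^sub>R
          (exp (\<i> * of_real (real_of_int (freq j) * (t $ i))) * phase (axis i n) t))"
        unfolding wave_level by simp
      also have "exp (\<i> * of_real (real_of_int (freq j) * (t $ i))) * phase (axis i n) t =
          exp (\<i> * of_real (real_of_int (freq j - n) * (t $ i)))"
        unfolding phase_axis exp_add[symmetric] by (simp add: algebra_simps)
      finally show ?thesis .
    qed
    then show ?thesis
      by (simp only: integral_mult_right_zero torus_integral_slab_interval mult.left_commute)
  qed
  then show ?thesis
    using integral_sums_fibres[OF J integrable_mult_phase[OF assms, of "axis i n"]]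
    by (simp only: fcoef_def)
qed

text \<open>The pieces have disjoint supports and the wave has modulus 1 on each, so the
  \<open>L^p\<close> norm is a weighted \<open>l^p\<close> norm of the coefficients.\<close>

lemma powr_step_sums:
  fixes i :: "'d::finite" and \<alpha> :: "nat \<Rightarrow> complex" and p :: real
  assumes "integrable (torus :: (real^'d) measure) (\<lambda>t. cmod (\<alpha> (level (t $ i)) * wave (t $ i)) powr p)"
  shows "(\<lambda>j. (2 * pi) ^ (CARD('d) - 1) * (cmod (\<alpha> j) powr p * len j)) sums
    (\<integral>t. cmod (\<alpha> (level (t $ i)) * wave (t $ i)) powr p \<partial>(torus :: (real^'d) measure))"
proof -
  let ?f = "\<lambda>t::real^'d. cmod (\<alpha> (level (t $ i)) * wave (t $ i)) powr p"
  have J: "(\<lambda>t::real^'d. level (t $ i)) \<in> measurable torus (count_space UNIV)"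
    by (rule measurable_compose[OF torus_component_measurable level_measurable])
  have "(\<integral>t. (if level (t $ i) = j then ?f t else 0) \<partial>torus) =
      (2 * pi) ^ (CARD('d) - 1) * (cmod (\<alpha> j) powr p * len j)" for j
  proof -
    have "(if level (t $ i) = j then ?f t else 0) = cmod (\<alpha> j) powr p * indicator {len j<..2 * len j} (t $ i)" for t :: "real^'d"
    proof -
      have "(if level (t $ i) = j then ?f t else 0) =
          cmod (if level (t $ i) = j then \<alpha> (level (t $ i)) * wave (t $ i) else 0) powr p" by simp
      also have "\<dots> = cmod (\<alpha> j) powr p * indicator {len j<..2 * len j} (t $ i)"
        unfolding wave_level by (simp add: norm_mult norm_exp_eq_Re indicator_def)
      finally show ?thesis .
    qed
    moreover have "(\<integral>t. indicator {len j<..2 * len j} (t $ i) \<partial>(torus :: (real^'d) measure)) = (2 * pi) ^ (CARD('d) - 1) * len j"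
    proof -
      have "complex_of_real (\<integral>t. indicator {len j<..2 * len j} (t $ i) \<partial>(torus :: (real^'d) measure)) =
          (\<integral>t. indicator {len j<..2 * len j} (t $ i) *\<^sub>R exp (\<i> * of_real (0 * (t $ i))) \<partial>(torus :: (real^'d) measure))"
        unfolding integral_complex_of_real[symmetric] by (simp add: scaleR_conv_of_real)
      also have "\<dots> = of_real ((2 * pi) ^ (CARD('d) - 1) * len j)"
        unfolding torus_integral_slab_interval osc_0 by simp
      finally show ?thesis unfolding of_real_eq_iff .
    qed
    ultimately show ?thesis by (simp only: integral_mult_right_zero mult.left_commute)
  qed
  then show ?thesis
    using integral_sums_fibres[OF J assms] by simp
qed

section \<open>Isolating one piece near its own frequency\<close>

lemma norm_sums_ge:
  fixes u :: "nat \<Rightarrow> complex"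
  assumes s: "u sums s" and b: "summable b" and ub: "\<And>i. i \<noteq> j \<Longrightarrow> cmod (u i) \<le> b i" and b0: "\<And>i. b i \<ge> 0"
  shows "cmod (u j) - suminf b \<le> cmod s"
proof -
  define v where "v i = (if i = j then 0 else u i)" for i
  have vb: "cmod (v i) \<le> b i" for i using ub b0 by (simp add: v_def)
  have v: "v sums (s - u j)"
  proof -
    have "(\<lambda>i. u i - (if i = j then u i else 0)) sums (s - u j)"
      by (intro sums_diff s sums_single)
    moreover have "v = (\<lambda>i. u i - (if i = j then u i else 0))" by (auto simp: v_def)
    ultimately show ?thesis by simp
  qed
  have "summable (\<lambda>i. cmod (v i))" by (rule summable_comparison_test'[OF b, of 0]) (simp add: vb)
  then have "cmod (suminf v) \<le> (\<Sum>i. cmod (v i))" by (rule summable_norm)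
  also have "\<dots> \<le> suminf b" by (rule suminf_le[OF vb \<open>summable (\<lambda>i. cmod (v i))\<close> b])
  finally have "cmod (s - u j) \<le> suminf b" using sums_unique[OF v] by simp
  moreover have "cmod (u j) \<le> cmod (s - u j) + cmod s"
    using norm_triangle_ineq4[of s "s - u j"] by simp
  ultimately show ?thesis by linarith
qed

text \<open>The larger of the two frequencies dominates, since consecutive ones differ by the factor
  16 and the shift \<open>r\<close> is at most \<open>2 * 16 ^ j\<close>. Writing the gap as a
  product in \<open>i\<close> and \<open>j\<close> gives interference that sums over one index and
  decays in the other.\<close>

lemma freq_gap:
  assumes "i \<noteq> j" "0 \<le> r" "r < 2 ^ Suc j"
  shows "32768 * 4 ^ i * 4 ^ j \<le> \<bar>freq i - (freq j + r)\<bar>"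
proof -
  have pos: "(0::int) < 16 ^ i" "(0::int) < 16 ^ j" by simp_all
  have r: "r \<le> 2 * 16 ^ j"
  proof -
    have "(2::int) ^ j \<le> 16 ^ j" by (rule power_mono) auto
    then show ?thesis using assms by simp
  qed
  have step: "16 * (16::int) ^ a \<le> 16 ^ b" if "a < b" for a b :: nat
    using power_increasing[of "Suc a" b "16::int"] that by simp
  have prod: "(4::int) ^ a * 4 ^ b \<le> 16 ^ b" if "a < b" for a b :: nat
  proof -
    have "(4::int) ^ a * 4 ^ b \<le> 4 ^ b * 4 ^ b"
      using that by (intro mult_right_mono power_increasing) auto
    also have "\<dots> = 16 ^ b" by (simp add: power_mult_distrib[symmetric])
    finally show ?thesis .
  qed
  show ?thesis
  proof (cases "i < j")
    case True
    then have "32768 * 16 ^ j \<le> freq j + r - freq i"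
      unfolding freq_def using step[OF True] pos assms(2) by linarith
    then show ?thesis using prod[OF True] by linarith
  next
    case False
    then have *: "j < i" using assms(1) by simp
    then have "32768 * 16 ^ i \<le> freq i - (freq j + r)"
      unfolding freq_def using step[OF *] pos r by linarith
    then show ?thesis using prod[OF *] by (simp add: mult.commute mult.left_commute)
  qed
qed

text \<open>Piece \<open>j\<close> sees only the frequency \<open>- r\<close>, and
  \<open>r * len j\<close> stays below \<open>2 ^ Suc j * len j = 1 / 2\<close>, so
  \<open>norm_osc_ge\<close> applies. All other pieces are far away in frequency and together form
  the error.\<close>

lemma fcoef_step_lower:
  fixes i :: "'d::finite" and \<alpha> :: "nat \<Rightarrow> complex"
  assumes int: "integrable (torus :: (real^'d) measure) (\<lambda>t. \<alpha> (level (t $ i)) * wave (t $ i))"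
    and P: "P \<ge> 0" "\<And>k. cmod (\<alpha> k) * len k \<le> P" and r: "0 \<le> r" "r < 2 ^ Suc j"
  shows "(2 * pi) ^ (CARD('d) - 1) * (cmod (\<alpha> j) * len j / 2 - P * (1 / 4) ^ j / 2048) \<le>
    cmod (fcoef (\<lambda>t::real^'d. \<alpha> (level (t $ i)) * wave (t $ i)) (axis i (freq j + r)))"
proof -
  let ?D = "(2 * pi) ^ (CARD('d) - 1) :: real"
  have D: "?D \<ge> 0" by simp
  define u where "u k = of_real ?D * (\<alpha> k * osc k (real_of_int (freq k - (freq j + r))))" for k
  \<comment> \<open>The gap gives \<open>2 / 32768 = 1 / 16384\<close>, and the coefficient bound
    costs 4, whence \<open>1 / 4096\<close>. The geometric series doubles this to the
    \<open>1 / 2048\<close> of the claim.\<close>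
  define b where "b k = ?D * (P * (1 / 4) ^ j / 4096) * (1 / 2) ^ k" for k :: nat
  have "cmod (u k) \<le> b k" if "k \<noteq> j" for k
  proof -
    let ?k = "real_of_int (freq k - (freq j + r))"
    have "real_of_int (32768 * 4 ^ k * 4 ^ j) \<le> real_of_int \<bar>freq k - (freq j + r)\<bar>"
      using freq_gap[OF that r] by (simp only: of_int_le_iff)
    then have gap: "32768 * 4 ^ k * 4 ^ j \<le> \<bar>?k\<bar>" by simp
    moreover have pos: "(0::real) < 32768 * 4 ^ k * 4 ^ j" by simp
    ultimately have k0: "?k \<noteq> 0" by linarith
    have "cmod (osc k ?k) \<le> 2 / \<bar>?k\<bar>" by (rule norm_osc_le[OF k0])
    also have "\<dots> \<le> 2 / (32768 * 4 ^ k * 4 ^ j)"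
      using gap pos k0 by (intro divide_left_mono mult_pos_pos) auto
    also have "\<dots> = (1 / 4) ^ k * (1 / 4) ^ j / 16384"
      by (simp add: power_one_over field_simps)
    finally have osc: "cmod (osc k ?k) \<le> (1 / 4) ^ k * (1 / 4) ^ j / 16384" .
    \<comment> \<open>Here \<open>4 * 2 ^ k\<close> is \<open>1 / len k\<close>; its growth is
      beaten by the factor \<open>(1 / 4) ^ k\<close> in the bound on \<open>osc\<close>.\<close>
    have al: "cmod (\<alpha> k) \<le> P * (4 * 2 ^ k)"
    proof -
      have "cmod (\<alpha> k) = (cmod (\<alpha> k) * len k) * (4 * 2 ^ k)"
        using len_mult_power[of k] by (simp add: mult.assoc mult.commute[of "2 ^ k"])
      also have "\<dots> \<le> P * (4 * 2 ^ k)" by (intro mult_right_mono P(2)) simp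
      finally show ?thesis .
    qed
    have "cmod (\<alpha> k) * cmod (osc k ?k) \<le> (P * (4 * 2 ^ k)) * ((1 / 4) ^ k * (1 / 4) ^ j / 16384)"
      using P(1) by (intro mult_mono al osc) auto
    also have "\<dots> = P * (1 / 4) ^ j / 4096 * (2 ^ k * (1 / 4) ^ k)" by simp
    also have "(2::real) ^ k * (1 / 4) ^ k = (1 / 2) ^ k" by (simp add: power_mult_distrib[symmetric])
    finally show ?thesis
      unfolding u_def b_def norm_mult norm_of_real using D
      by (simp only: mult.assoc abs_of_nonneg mult_left_mono)
  qed
  moreover have "b k \<ge> 0" for k using P(1) by (simp add: b_def)
  moreover have bs: "b sums (?D * (P * (1 / 4) ^ j / 4096) * 2)"
    unfolding b_def using geometric_sums[of "1 / 2 :: real"] by (intro sums_mult) simp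
  moreover have us: "u sums fcoef (\<lambda>t::real^'d. \<alpha> (level (t $ i)) * wave (t $ i)) (axis i (freq j + r))"
    unfolding u_def by (rule fcoef_step_sums[OF int])
  ultimately have "cmod (u j) - ?D * (P * (1 / 4) ^ j / 4096) * 2 \<le>
      cmod (fcoef (\<lambda>t::real^'d. \<alpha> (level (t $ i)) * wave (t $ i)) (axis i (freq j + r)))"
    using norm_sums_ge[OF us sums_summable[OF bs], of j] sums_unique[OF bs] by simp
  moreover have "?D * (cmod (\<alpha> j) * len j / 2) \<le> cmod (u j)"
  proof -
    have "real_of_int r \<le> real_of_int (2 ^ Suc j)" using r(2) by (simp only: of_int_le_iff)
    then have "\<bar>real_of_int (freq j - (freq j + r))\<bar> * len j \<le> 2 * 2 ^ j * len j"
      using r(1) by (intro mult_right_mono) auto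
    also have "\<dots> = 1 / 2" using len_mult_power[of j] by simp
    finally have "len j / 2 \<le> cmod (osc j (real_of_int (freq j - (freq j + r))))"
      by (rule norm_osc_ge)
    then have "cmod (\<alpha> j) * (len j / 2) \<le> cmod (\<alpha> j) * cmod (osc j (real_of_int (freq j - (freq j + r))))"
      by (rule mult_left_mono) simp
    from mult_left_mono[OF this D] show ?thesis
      unfolding u_def norm_mult norm_of_real abs_of_nonneg[OF D] by simp
  qed
  ultimately show ?thesis by (simp add: algebra_simps)
qed

section \<open>Comparison of Lorentz and Lebesgue norms on the step space\<close>

lemma dyadic_main_term:
  fixes p a :: real
  assumes "1 < p" "p < 2" "a \<ge> 0"
  shows "a powr p * len j / 16 \<le> (2 ^ j) powr (p - 1) * (a * len j / 2) powr p"
proof -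
  let ?N = "(2::real) ^ j"
  have "len j powr 1 * len j powr (p - 1) = len j powr p" by (simp only: powr_add[symmetric]) simp
  then have 1: "len j powr p = len j * len j powr (p - 1)" by (simp add: less_imp_le)
  \<comment> \<open>The block size is inverse to the slab width up to the factor
    \<open>1 / 4\<close>, so only one power of \<open>len j\<close> survives, as in the
    \<open>L^p\<close> norm.\<close>
  have 2: "?N powr (p - 1) * len j powr (p - 1) = (1 / 4) powr (p - 1)"
    by (subst powr_mult[symmetric]) (simp add: len_mult_power)
  have "(1 / 4) powr 1 \<le> (1 / 4 :: real) powr (p - 1)" using assms by (intro powr_mono') auto
  moreover have "(2::real) powr p \<le> 2 powr 2" using assms by (intro powr_mono) auto
  ultimately have "(1 / 4 :: real) / 4 \<le> (1 / 4) powr (p - 1) / 2 powr p"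
    by (intro frac_le) auto
  then have "(a powr p * len j) * (1 / 16) \<le> (a powr p * len j) * ((1 / 4) powr (p - 1) / 2 powr p)"
    by (intro mult_left_mono) (auto simp: less_imp_le)
  also have "\<dots> = (2 ^ j) powr (p - 1) * (a * len j / 2) powr p"
    unfolding 2[symmetric] by (simp add: powr_divide powr_mult 1)
  finally show ?thesis by simp
qed

text \<open>Of the two factors \<open>2 powr (- j * p)\<close> in the error, one cancels the dyadic
  weight and the other leaves a summable \<open>(1 / 2) ^ j\<close>.\<close>

lemma dyadic_error_term:
  fixes p Q :: real
  assumes "1 < p" "Q \<ge> 0"
  shows "(2 ^ j) powr (p - 1) * (Q powr (1 / p) * (1 / 4) ^ j / 2048) powr p \<le> Q * (1 / 2) ^ j / 2048"
proof -
  let ?N = "(2::real) ^ j" and ?h = "(1 / 2 :: real) ^ j"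
  have h: "0 < ?h" "?h \<le> 1" by (simp_all add: power_le_one)
  have "(1 / 4 :: real) ^ j = ?h * ?h" by (simp add: power_mult_distrib[symmetric])
  then have e: "(Q powr (1 / p) * (1 / 4) ^ j / 2048) powr p = Q * (?h powr p * ?h powr p) / 2048 powr p"
    using assms by (simp add: powr_mult powr_divide powr_powr)
  have "?N powr (p - 1) * ?h powr p \<le> ?N powr p * ?h powr p"
    by (intro mult_right_mono powr_mono) auto
  also have "\<dots> = 1"
    by (subst powr_mult[symmetric]) (simp add: power_mult_distrib[symmetric])
  finally have 1: "?N powr (p - 1) * ?h powr p \<le> 1" .
  have "?h powr p \<le> ?h powr 1" using h assms by (intro powr_mono') auto
  then have 2: "?h powr p \<le> ?h" by simp
  have "(2048::real) powr 1 \<le> 2048 powr p" using assms by (intro powr_mono) auto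
  then have 3: "(2048::real) \<le> 2048 powr p" by simp
  have "?N powr (p - 1) * (Q * (?h powr p * ?h powr p) / 2048 powr p) =
      Q * ((?N powr (p - 1) * ?h powr p) * ?h powr p) / 2048 powr p" by simp
  also have "\<dots> \<le> Q * (1 * ?h) / 2048"
    using assms 1 2 3 h by (intro frac_le mult_left_mono mult_mono) auto
  finally show ?thesis unfolding e by simp
qed

text \<open>Each block recovers one term of the \<open>L^p\<close> sum up to an error proportional
  to the whole sum. Summed over blocks, the errors amount to \<open>1 / 256\<close> against
  \<open>1 / 16\<close> for the main terms and are absorbed.\<close>

lemma step_lorentz_lower:
  fixes i :: "'d::finite" and \<alpha> :: "nat \<Rightarrow> complex" and p q :: real
  defines "f \<equiv> (\<lambda>t::real^'d. \<alpha> (level (t $ i)) * wave (t $ i))"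
  assumes p: "1 < p" "p < 2" and pq: "1 / p + 1 / q = 1" and f: "f \<in> borel_measurable torus"
    and fp: "integrable torus (\<lambda>t. cmod (f t) powr p)"
  shows "(\<integral>t. cmod (f t) powr p \<partial>torus) \<le> 256 * (\<Sum>k. lorentz_term q p (fcoef f) k)"
proof -
  define D where "D = (2 * pi) ^ (CARD('d) - 1)"
  define \<Lambda> where "\<Lambda> = (\<Sum>k. lorentz_term q p (fcoef f) k)"
  have D1: "D \<ge> 1" unfolding D_def using pi_gt3 by (intro one_le_power) simp
  have int: "integrable torus f" using p f fp by (intro integrable_torus_of_powr) auto
  have bdd: "bounded (range (fcoef f))" by (rule bounded_fcoef[OF int])
  have smm: "summable (lorentz_term q p (fcoef f))" by (rule fcoef_lorentz(1)[OF p pq f fp])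
  define T where "T j = cmod (\<alpha> j) powr p * len j" for j
  have T0: "T j \<ge> 0" for j by (simp add: T_def less_imp_le)
  have IT: "(\<lambda>j. D * T j) sums (\<integral>t. cmod (f t) powr p \<partial>torus)"
    using powr_step_sums[of \<alpha> i p] fp by (simp add: f_def D_def T_def)
  then have sT: "summable T" using D1 by (intro summable_mult_D[of D T] sums_summable[OF IT]) simp
  define Q where "Q = suminf T"
  have IQ: "(\<integral>t. cmod (f t) powr p \<partial>torus) = D * Q"
    using sums_unique2[OF IT sums_mult[OF summable_sums[OF sT]]] by (simp add: Q_def)
  have Q0: "Q \<ge> 0" unfolding Q_def by (intro suminf_nonneg sT T0)
  \<comment> \<open>Provides the uniform bound \<open>P\<close> of \<open>fcoef_step_lower\<close>:
    as \<open>len k <= 1\<close>, the \<open>p\<close>-th power of the left side is at most the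
    single term \<open>T k\<close>.\<close>
  have \<alpha>Q: "cmod (\<alpha> k) * len k \<le> Q powr (1 / p)" for k
  proof -
    have "len k powr p \<le> len k powr 1"
      using p two_len_le[of k] len_pos[of k] by (intro powr_mono') auto
    then have "(cmod (\<alpha> k) * len k) powr p \<le> T k"
      by (simp add: T_def powr_mult mult_left_mono less_imp_le)
    also have "T k \<le> Q"
      unfolding Q_def using sum_le_suminf[OF sT, of "{k}"] T0 by simp
    finally have "((cmod (\<alpha> k) * len k) powr p) powr (1 / p) \<le> Q powr (1 / p)"
      using p by (intro powr_mono2) auto
    then show ?thesis using p by (simp add: powr_powr less_imp_le)
  qed
  define x where "x j = cmod (\<alpha> j) * len j / 2" for j
  define y where "y j = Q powr (1 / p) * (1 / 4) ^ j / 2048" for j :: nat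
  have y0: "y j \<ge> 0" for j by (simp add: y_def)
  \<comment> \<open>Truncation at zero because the dyadic bound takes nonnegative heights;
    \<open>x j \<le> m j + y j\<close> still holds.\<close>
  define m where "m j = max 0 (x j - y j)" for j
  have m0: "m j \<ge> 0" for j by (simp add: m_def)
  have F: "\<exists>F. finite F \<and> 2 ^ Suc j \<le> card F \<and> (\<forall>n\<in>F. D * m j \<le> cmod (fcoef f n))" for j
  proof -
    \<comment> \<open>A run of exactly as many frequencies as the dyadic block \<open>j\<close>
      requires, starting at the carrier frequency.\<close>
    let ?F = "(\<lambda>r. axis i (freq j + r)) ` {0..<(2::int) ^ Suc j}"
    have "inj_on (\<lambda>r::int. axis i (freq j + r)) {0..<2 ^ Suc j}"
      by (auto simp: inj_on_def axis_eq_axis)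
    then have "card ?F = card {0..<(2::int) ^ Suc j}" by (rule card_image)
    also have "\<dots> = 2 ^ Suc j" unfolding card_atLeastLessThan_int
      by (simp only: diff_zero nat_power_eq[OF zero_le_numeral] nat_numeral)
    finally have "2 ^ Suc j \<le> card ?F" by (rule eq_refl[OF sym])
    moreover have "D * m j \<le> cmod (fcoef f n)" if n: "n \<in> ?F" for n
    proof -
      obtain r where r: "n = axis i (freq j + r)" "r \<in> {0..<2 ^ Suc j}"
        using n by (rule imageE)
      have "D * (x j - y j) \<le> cmod (fcoef f n)"
        unfolding D_def x_def y_def f_def r(1) using r(2)
        by (intro fcoef_step_lower[OF int[unfolded f_def] _ \<alpha>Q]) auto
      then show ?thesis by (simp add: m_def max_def)
    qed
    moreover have "finite ?F" by (intro finite_imageI) simp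
    ultimately show ?thesis by blast
  qed
  have dy: "(\<Sum>j<J. (2 ^ j) powr (p - 1) * (D * m j) powr p) \<le> 2 * \<Lambda>" for J
    unfolding \<Lambda>_def using D1 m0 by (intro dyadic_le_lorentz[OF bdd p pq smm _ F]) auto
  \<comment> \<open>Splitting \<open>x j\<close> into \<open>m j\<close> and \<open>y j\<close>
    costs \<open>2 powr p <= 4\<close>, which turns the error constant \<open>1 / 2048\<close> into
    \<open>1 / 512\<close>.\<close>
  have block: "D powr p * T j / 16 \<le> 4 * ((2 ^ j) powr (p - 1) * (D * m j) powr p) + D powr p * Q / 512 * (1 / 2) ^ j" for j
  proof -
    let ?N = "(2::real) ^ j"
    have x0: "x j \<ge> 0" by (simp add: x_def less_imp_le)
    have "x j powr p \<le> (m j + y j) powr p"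
      using p x0 by (intro powr_mono2) (auto simp: m_def)
    also have "\<dots> \<le> 2 powr p * (m j powr p + y j powr p)"
      using p m0 y0 by (intro powr_add_le) auto
    also have "\<dots> \<le> 4 * (m j powr p + y j powr p)"
    proof (rule mult_right_mono)
      have "(2::real) powr p \<le> 2 powr 2" using p by (intro powr_mono) auto
      then show "2 powr p \<le> (4::real)" by simp
    qed simp
    finally have "?N powr (p - 1) * x j powr p \<le> ?N powr (p - 1) * (4 * (m j powr p + y j powr p))"
      by (rule mult_left_mono) simp
    moreover have "T j / 16 \<le> ?N powr (p - 1) * x j powr p"
      unfolding T_def x_def using p by (intro dyadic_main_term) auto
    moreover have "?N powr (p - 1) * y j powr p \<le> Q * (1 / 2) ^ j / 2048"
      unfolding y_def using p Q0 by (intro dyadic_error_term) auto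
    ultimately have "T j / 16 \<le> 4 * (?N powr (p - 1) * m j powr p) + Q * (1 / 2) ^ j / 512"
      by (simp add: distrib_left)
    then have "D powr p * (T j / 16) \<le> D powr p * (4 * (?N powr (p - 1) * m j powr p) + Q * (1 / 2) ^ j / 512)"
      by (rule mult_left_mono) simp
    also have "\<dots> = 4 * (?N powr (p - 1) * (D * m j) powr p) + D powr p * Q / 512 * (1 / 2) ^ j"
      by (simp add: powr_mult distrib_left)
    finally show ?thesis by simp
  qed
  have "(\<Sum>j<J. T j) \<le> (8 * \<Lambda> + D powr p * Q / 256) / (D powr p / 16)" for J
  proof -
    have "(\<Sum>j<J. D powr p * T j / 16) \<le>
        (\<Sum>j<J. 4 * ((2 ^ j) powr (p - 1) * (D * m j) powr p) + D powr p * Q / 512 * (1 / 2) ^ j)"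
      by (rule sum_mono) (rule block)
    also have "\<dots> = 4 * (\<Sum>j<J. (2 ^ j) powr (p - 1) * (D * m j) powr p) + D powr p * Q / 512 * (\<Sum>j<J. (1 / 2) ^ j)"
      by (simp only: sum.distrib sum_distrib_left)
    also have "\<dots> \<le> 4 * (2 * \<Lambda>) + D powr p * Q / 512 * 2"
    proof (intro add_mono mult_left_mono dy)
      show "(\<Sum>j<J. (1 / 2 :: real) ^ j) \<le> 2"
        using sum_le_suminf[OF summable_geometric[of "1 / 2 :: real"], of "{..<J}"] suminf_geometric[of "1 / 2 :: real"] by simp
    qed (use Q0 in auto)
    finally have "D powr p / 16 * (\<Sum>j<J. T j) \<le> 8 * \<Lambda> + D powr p * Q / 256"
      by (simp add: sum_distrib_left mult.commute[of Q])
    then show ?thesis using D1 by (simp add: pos_le_divide_eq mult.commute)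
  qed
  \<comment> \<open>The partial sums are bounded uniformly, so \<open>Q\<close> is too. It is finite
    and stands on both sides, hence can be absorbed; the resulting factor
    \<open>8 * 256 / 15\<close> is below 256.\<close>
  then have "Q \<le> (8 * \<Lambda> + D powr p * Q / 256) / (D powr p / 16)"
    unfolding Q_def[symmetric] using suminf_le_const[OF sT] Q_def by blast
  then have "D powr p * Q / 16 \<le> 8 * \<Lambda> + D powr p * Q / 256"
    using D1 by (simp add: pos_le_divide_eq mult.commute)
  \<comment> \<open>Uses \<open>D \<ge> 1\<close>; the left side is the integral to be
    bounded.\<close>
  moreover have "D * Q \<le> D powr p * Q"
  proof -
    have "D powr 1 \<le> D powr p" using D1 p by (intro powr_mono) auto
    then show ?thesis using D1 Q0 by (intro mult_right_mono) auto
  qed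
  moreover have "0 \<le> D * Q" using D1 Q0 by simp
  ultimately show ?thesis unfolding IQ \<Lambda>_def[symmetric] by linarith
qed

section \<open>Failure of strict singularity\<close>

lemma fourier_not_strictly_singular:
  fixes p q :: real
  assumes p: "1 < p" "p < 2" and pq: "1 / p + 1 / q = 1"
  shows "\<not> strictly_singular (Lp_space p) (lorentz_space q p)
    (fourier :: 'd::finite torus_fun \<Rightarrow> (int ^ 'd \<Rightarrow> complex))"
proof
  assume ss: "strictly_singular (Lp_space p) (lorentz_space q p) (fourier :: 'd torus_fun \<Rightarrow> (int ^ 'd \<Rightarrow> complex))"
  \<comment> \<open>Any coordinate serves.\<close>
  define i :: 'd where "i = undefined"
  define J where "J t = level (t $ i)" for t :: "real^'d"
  define w where "w t = wave (t $ i)" for t :: "real^'d"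
  have J: "J \<in> measurable torus (count_space UNIV)"
    unfolding J_def by (rule measurable_compose[OF torus_component_measurable level_measurable])
  have w: "w \<in> borel_measurable torus"
    unfolding w_def by (rule measurable_compose[OF torus_component_measurable wave_measurable])
  \<comment> \<open>Otherwise the \<open>L^1\<close> norm of the \<open>j\<close>-th piece would be
    zero, whereas \<open>powr_step_sums\<close> with exponent 1 evaluates it to a positive multiple
    of \<open>len j\<close>.\<close>
  have nz: "\<not> (AE t in torus. J t = j \<longrightarrow> w t = 0)" for j
  proof
    assume ae: "AE t in torus. J t = j \<longrightarrow> w t = 0"
    let ?\<alpha> = "\<lambda>k. if k = j then 1 else (0::complex)"
    have z: "AE t in torus. cmod (?\<alpha> (J t) * w t) powr 1 = 0"
      using ae by eventually_elim auto
    have meas: "(\<lambda>t. cmod (?\<alpha> (J t) * w t) powr 1) \<in> borel_measurable torus"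
      using step_measurable[OF J w, of ?\<alpha>] by measurable
    have "integrable torus (\<lambda>t. cmod (?\<alpha> (J t) * w t) powr 1)"
      by (subst integrable_cong_AE[OF meas _ z]) auto
    moreover have "(\<integral>t. cmod (?\<alpha> (J t) * w t) powr 1 \<partial>torus) = 0"
      by (subst integral_cong_AE[OF meas _ z]) auto
    ultimately have "(\<lambda>k. (2 * pi) ^ (CARD('d) - 1) * (cmod (?\<alpha> k) powr 1 * len k)) sums 0"
      using powr_step_sums[of ?\<alpha> i 1] by (simp add: J_def w_def)
    moreover have "(\<lambda>k. (2 * pi) ^ (CARD('d) - 1) * (cmod (?\<alpha> k) powr 1 * len k)) =
        (\<lambda>k. if k = j then (2 * pi) ^ (CARD('d) - 1) * len k else 0)" by auto
    ultimately have "(2 * pi) ^ (CARD('d) - 1) * len j = 0"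
      using sums_unique2[OF _ sums_single[of j "\<lambda>k. (2 * pi) ^ (CARD('d) - 1) * len k"]] by metis
    then show False using len_pos[of j] by simp
  qed
  have "closed_subspace (Lp_space p) (step_space p J w)"
    by (rule closed_subspace_step_space[OF J w]) (use p in simp)
  moreover have "infinite_dimensional (Lp_space p) (step_space p J w)"
    by (rule infinite_dimensional_step_space[OF J w _ _ nz]) (use p in \<open>auto simp: w_def norm_wave_le\<close>)
  \<comment> \<open>Any tolerance below \<open>1 / 256\<close> contradicts the lower bound for unit
    vectors obtained from \<open>step_lorentz_lower\<close>.\<close>
  moreover have "(0::real) < 1 / 512" by simp
  ultimately obtain \<xi> where \<xi>: "\<xi> \<in> step_space p J w" "Lp_norm p \<xi> = 1"
      "vnorm (lorentz_space q p) (fourier \<xi>) \<le> 1 / 512"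
    using ss unfolding strictly_singular_def Lp_space_def normed_sp.simps by blast
  then obtain \<alpha> where \<alpha>: "\<xi> = abs_torus_fun (\<lambda>t. \<alpha> (J t) * w t)"
      and fp: "integrable torus (\<lambda>t. cmod (\<alpha> (J t) * w t) powr p)"
    unfolding step_space_def by blast
  have f: "(\<lambda>t. \<alpha> (J t) * w t) \<in> borel_measurable torus" by (rule step_measurable[OF J w])
  let ?I = "\<integral>t. cmod (\<alpha> (J t) * w t) powr p \<partial>torus"
  let ?\<Lambda> = "\<Sum>k. lorentz_term q p (fcoef (\<lambda>t. \<alpha> (J t) * w t)) k"
  have "?I powr (1 / p) = 1"
    using \<xi>(2) unfolding \<alpha> Lp_norm.abs_eq[OF f[folded torus_rel_refl_iff]] .
  then have "?I = 1"
  proof -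
    have "?I \<ge> 0" by simp
    then have "?I = (?I powr (1 / p)) powr p" using p by (simp add: powr_powr)
    also have "\<dots> = 1" by (simp only: \<open>?I powr (1 / p) = 1\<close>) simp
    finally show ?thesis .
  qed
  moreover have "?I \<le> 256 * ?\<Lambda>"
    using step_lorentz_lower[OF p pq, of \<alpha> i] f fp by (simp add: J_def w_def)
  ultimately have "1 / 256 \<le> ?\<Lambda>" by simp
  then have "(1 / 256) powr (1 / p) \<le> ?\<Lambda> powr (1 / p)" using p by (intro powr_mono2) auto
  also have "\<dots> \<le> 1 / 512"
    using \<xi>(3) unfolding \<alpha> fourier_abs[OF f] by (simp add: lorentz_space_def)
  finally have "(1 / 256) powr (1 / p) \<le> (1 / 512 :: real)" .
  \<comment> \<open>For a base below 1 the smaller exponent \<open>1 / p\<close> gives the larger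
    power, so the transform has norm at least \<open>1 / 256\<close>.\<close>
  moreover have "(1 / 256) powr 1 \<le> (1 / 256 :: real) powr (1 / p)" using p by (intro powr_mono') auto
  ultimately show False by simp
qed

theorem theorem5p1:
  fixes p q :: real
  assumes "1 < p" and "p < 2" and "1 / p + 1 / q = 1"
  shows "bounded_linear_operator (Lp_space p) (lorentz_space q p)
           (fourier :: 'd::finite torus_fun \<Rightarrow> (int ^ 'd \<Rightarrow> complex)) \<and>
         \<not> strictly_singular (Lp_space p) (lorentz_space q p)
           (fourier :: 'd torus_fun \<Rightarrow> (int ^ 'd \<Rightarrow> complex))"
  using fourier_bounded[OF assms] fourier_not_strictly_singular[OF assms] by blast

end
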